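(* Let $n\ge 2$ and let $\mathcal Q$ be the equioriented quiver of type $A_n$, $1\to2\to\cdots\to n$. Then $\{\beta(\eta) : \eta\in\bigcup_{\sigma\in P_{\mathcal Q}}\Gamma_\sigma\}$ is precisely the set of real Schur roots of $\mathcal Q$.
   Context: Let $\mathcal Q$ be an acyclic connected quiver with $N$ vertices labelled by $I=\{1,\dots,N\}$. A real Schur root of $\mathcal Q$ is the dimension vector of an indecomposable module $M$ over the path algebra of $\mathcal Q$ (over an algebraically closed field) with $\mathrm{Ext}^1(M,M)=0$; dimension vectors $(m_i)$ are identified with $\sum m_i\alpha_i$. **Weyl group.** The Cartan matrix of $\mathcal Q$ has $a_{ii}=2$ and $a_{ij}=-(\text{number of arrows between } i \text{ and } j)$ for $i\neq j$. Let $\alpha_i$ be the simple roots, $s_i(\alpha_j)=\alpha_j-a_{ij}\alpha_i$ the simple reflections, $W$ the Weyl group. Positive real roots correspond bijectively to reflections in $W$, $w\alpha_i\leftrightarrow ws_iw^{-1}$. Let $\mathfrak W$ be the set of words $i_1\cdots i_k$ in the alphabet $I$ with no two consecutive letters equal; for $w\in W$ let $R_w\subset\mathfrak W$ be the set of words with $s_{i_1}\cdots s_{i_k}=w$ (not necessarily reduced), and let $R=\bigcup R_w$ over all reflections $w\in W$. **Surfaces.** Let $P_{\mathcal Q}\subset S_N$ be the set of permutations $\sigma$ of $I$ such that there is no arrow from $\sigma(j)$ to $\sigma(i)$ for any $j>i$. For $\sigma\in P_{\mathcal Q}$ take two copies $G_1,G_2$ of a regular $N$-gon (a bigon if $N=2$),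 and label the edges of each by $T_{\sigma(1)},\dots,T_{\sigma(N)}$ counter-clockwise. On $G_i$ let $L_i$ be the line segment from the center of $G_i$ to the common endpoint of $T_{\sigma(N)}$ and $T_{\sigma(1)}$ at which the counter-clockwise labelling begins (the end of $T_{\sigma(N)}$ and the beginning of $T_{\sigma(1)}$ in counter-clockwise order). Orient all edges of $G_1$ counter-clockwise and all edges of $G_2$ clockwise. Let $\Sigma_\sigma$ be the compact surface obtained by gluing $G_1$ and $G_2$ along edges of the same label according to orientation. Let $\mathcal T=T_1\cup\cdots\cup T_N\subset\Sigma_\sigma$ and let $V$ be the set of images of the vertices of the polygons (one point if $N$ is odd, two points if $N$ is even). **Admissible curves.** A $\sigma$-admissible curve is a continuous $\eta:[0,1]\to\Sigma_\sigma$ such that: (1) $\eta(x)\in V$ iff $x\in\{0,1\}$; (2) there is $\epsilon>0$ with $\eta([0,\epsilon])\subset L_1$ and $\eta([1-\epsilon,1])\subset L_2$; (3) if $\eta(x)\in\mathcal T\setminus V$ then $\eta([x-\epsilon,x+\epsilon])$ meets $\mathcal T$ transversally for sufficiently small $\epsilon>0$; (4) $\upsilon(\eta)\in R$, where $\upsilon(\eta)=i_1\cdots i_k$ is given by $\{x\in(0,1):\eta(x)\in\mathcal T\}=\{x_1<\cdots<x_k\}$ and $\eta(x_\ell)\in T_{i_\ell}$. Let $\Gamma_\sigma$ be the set of (isotopy classes of) $\sigma$-admissible curves without self-intersections, i.e. $\eta(x_1)=\eta(x_2)$ implies $x_1=x_2$ or $\{x_1,x_2\}=\{0,1\}$. For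 $\eta\in\Gamma_\sigma$, $\beta(\eta)$ is the positive real root corresponding to the reflection $w$ with $\upsilon(\eta)\in R_w$. *)

theory Defs
  imports
    "HOL-Analysis.Analysis"
    "HOL-Library.Poly_Mapping"
    "HOL-Combinatorics.Permutations"
    "HOL-Computational_Algebra.Polynomial"
    "Graph_Theory.Arc_Walk"
begin

section \<open>Quivers\<close>

text \<open>
  A quiver is a finite directed multigraph whose vertex set is \<open>{1..N}\<close>, \<open>N = card (verts Q)\<close>.
\<close>

type_synonym 'b quiver = "(nat, 'b) pre_digraph"

definition equioriented_A :: "nat \<Rightarrow> (nat \<times> nat) quiver" where
  "equioriented_A n =
     \<lparr>verts = {1..n}, arcs = {(i, Suc i) | i. 1 \<le> i \<and> i < n}, tail = fst, head = snd\<rparr>"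

section \<open>Modules over the path algebra\<close>

text \<open>
  A path is a triple (start, list of arcs, end); the empty arc list gives the lazy path at
  a vertex.  Elements of the path algebra are finitely supported functions on paths.
  A product \<open>p \<cdot> q\<close> of paths means first \<open>q\<close>, then \<open>p\<close>, so that left
  modules are covariant representations of the quiver: an arrow \<open>i \<rightarrow> j\<close> acts as a
  map \<open>e\<^sub>i M \<rightarrow> e\<^sub>j M\<close>.
\<close>

type_synonym 'b qpath = "nat \<times> 'b list \<times> nat"

definition qpaths :: "'b quiver \<Rightarrow> 'b qpath set" where
  "qpaths Q = {(u, p, v). pre_digraph.awalk Q u p v}"

definition scl :: "'k::field \<Rightarrow> ('a \<Rightarrow>\<^sub>0 'k) \<Rightarrow> ('a \<Rightarrow>\<^sub>0 'k)" where
  "scl c f = Poly_Mapping.map ((*) c) f"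

lemma lookup_scl [simp]: "Poly_Mapping.lookup (scl c f) x = c * Poly_Mapping.lookup f x"
  by (simp add: scl_def Poly_Mapping.map.rep_eq when_def)

global_interpretation pmv: vector_space "scl :: 'k::field \<Rightarrow> ('a \<Rightarrow>\<^sub>0 'k) \<Rightarrow> ('a \<Rightarrow>\<^sub>0 'k)"
  by unfold_locales
    (auto intro!: poly_mapping_eqI simp: lookup_add algebra_simps)

definition pa_carrier :: "'b quiver \<Rightarrow> ('b qpath \<Rightarrow>\<^sub>0 'k::field) set" where
  "pa_carrier Q = {a. Poly_Mapping.keys a \<subseteq> qpaths Q}"

definition path_mult :: "'b qpath \<Rightarrow> 'b qpath \<Rightarrow> ('b qpath \<Rightarrow>\<^sub>0 'k::field)" where
  "path_mult p q = (case (p, q) of ((u, xs, v), (u', ys, v')) \<Rightarrow>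
     if v' = u then Poly_Mapping.single (u', ys @ xs, v) 1 else 0)"

definition pa_mult ::
    "('b qpath \<Rightarrow>\<^sub>0 'k::field) \<Rightarrow> ('b qpath \<Rightarrow>\<^sub>0 'k) \<Rightarrow> ('b qpath \<Rightarrow>\<^sub>0 'k)" where
  "pa_mult a b = (\<Sum>p\<in>Poly_Mapping.keys a. \<Sum>q\<in>Poly_Mapping.keys b.
     scl (Poly_Mapping.lookup a p * Poly_Mapping.lookup b q) (path_mult p q))"

definition pa_idem :: "nat \<Rightarrow> ('b qpath \<Rightarrow>\<^sub>0 'k::field)" where
  "pa_idem i = Poly_Mapping.single (i, [], i) 1"

definition pa_one :: "'b quiver \<Rightarrow> ('b qpath \<Rightarrow>\<^sub>0 'k::field)" where
  "pa_one Q = (\<Sum>i\<in>verts Q. pa_idem i)"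

text \<open>
  Finite-dimensional left modules.  The underlying vector spaces are taken inside the
  space of finitely supported functions \<open>nat \<Rightarrow> 'k\<close>, which has countably infinite dimension;
  hence every finite-dimensional module is isomorphic to one of this form.
\<close>

record (overloaded) ('b, 'k) pa_module =
  mcarrier :: "(nat \<Rightarrow>\<^sub>0 'k) set"
  mact :: "('b qpath \<Rightarrow>\<^sub>0 'k) \<Rightarrow> (nat \<Rightarrow>\<^sub>0 'k) \<Rightarrow> (nat \<Rightarrow>\<^sub>0 'k)"

definition is_pa_module :: "'b quiver \<Rightarrow> ('b, 'k::field) pa_module \<Rightarrow> bool" where
  "is_pa_module Q M \<longleftrightarrow>
     pmv.subspace (mcarrier M) \<and>
     (\<exists>B. finite B \<and> pmv.span B = mcarrier M) \<and>
     (\<forall>a\<in>pa_carrier Q. \<forall>x\<in>mcarrier M. mact M a x \<in> mcarrier M) \<and>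
     (\<forall>a\<in>pa_carrier Q. \<forall>x\<in>mcarrier M. \<forall>y\<in>mcarrier M.
        mact M a (x + y) = mact M a x + mact M a y) \<and>
     (\<forall>a\<in>pa_carrier Q. \<forall>b\<in>pa_carrier Q. \<forall>x\<in>mcarrier M.
        mact M (a + b) x = mact M a x + mact M b x) \<and>
     (\<forall>a\<in>pa_carrier Q. \<forall>c. \<forall>x\<in>mcarrier M.
        mact M (scl c a) x = scl c (mact M a x) \<and> mact M a (scl c x) = scl c (mact M a x)) \<and>
     (\<forall>a\<in>pa_carrier Q. \<forall>b\<in>pa_carrier Q. \<forall>x\<in>mcarrier M.
        mact M (pa_mult a b) x = mact M a (mact M b x)) \<and>
     (\<forall>x\<in>mcarrier M. mact M (pa_one Q) x = x)"

definition is_submodule ::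
    "'b quiver \<Rightarrow> ('b, 'k::field) pa_module \<Rightarrow> (nat \<Rightarrow>\<^sub>0 'k) set \<Rightarrow> bool" where
  "is_submodule Q M S \<longleftrightarrow>
     S \<subseteq> mcarrier M \<and> pmv.subspace S \<and> (\<forall>a\<in>pa_carrier Q. \<forall>x\<in>S. mact M a x \<in> S)"

definition indecomposable :: "'b quiver \<Rightarrow> ('b, 'k::field) pa_module \<Rightarrow> bool" where
  "indecomposable Q M \<longleftrightarrow>
     mcarrier M \<noteq> {0} \<and>
     \<not> (\<exists>S T. is_submodule Q M S \<and> is_submodule Q M T \<and> S \<noteq> {0} \<and> T \<noteq> {0} \<and>
          S \<inter> T = {0} \<and> {s + t | s t. s \<in> S \<and> t \<in> T} = mcarrier M)"

definition pa_module_hom :: "'b quiver \<Rightarrow> ('b, 'k::field) pa_module \<Rightarrow> ('b, 'k) pa_module \<Rightarrow>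
    ((nat \<Rightarrow>\<^sub>0 'k) \<Rightarrow> (nat \<Rightarrow>\<^sub>0 'k)) \<Rightarrow> bool" where
  "pa_module_hom Q M L f \<longleftrightarrow>
     (\<forall>x\<in>mcarrier M. f x \<in> mcarrier L) \<and>
     (\<forall>x\<in>mcarrier M. \<forall>y\<in>mcarrier M. f (x + y) = f x + f y) \<and>
     (\<forall>a\<in>pa_carrier Q. \<forall>x\<in>mcarrier M. f (mact M a x) = mact L a (f x))"

definition short_exact :: "'b quiver \<Rightarrow> ('b, 'k::field) pa_module \<Rightarrow> ('b, 'k) pa_module \<Rightarrow>
    ('b, 'k) pa_module \<Rightarrow> ((nat \<Rightarrow>\<^sub>0 'k) \<Rightarrow> (nat \<Rightarrow>\<^sub>0 'k)) \<Rightarrow> ((nat \<Rightarrow>\<^sub>0 'k) \<Rightarrow> (nat \<Rightarrow>\<^sub>0 'k)) \<Rightarrow> bool" where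
  "short_exact Q L E M f g \<longleftrightarrow>
     pa_module_hom Q L E f \<and> pa_module_hom Q E M g \<and>
     inj_on f (mcarrier L) \<and>
     f ` mcarrier L = {x \<in> mcarrier E. g x = 0} \<and>
     g ` mcarrier E = mcarrier M"

text \<open>
  Yoneda's \<open>Ext\<^sup>1(M, L)\<close> consists of the classes of extensions \<open>0 \<rightarrow> L \<rightarrow> E \<rightarrow> M \<rightarrow> 0\<close>; its zero
  element is the class of the split extensions.
\<close>

definition Ext1_zero ::
    "'b quiver \<Rightarrow> ('b, 'k::field) pa_module \<Rightarrow> ('b, 'k) pa_module \<Rightarrow> bool" where
  "Ext1_zero Q M L \<longleftrightarrow>
     (\<forall>E f g. is_pa_module Q E \<and> short_exact Q L E M f g \<longrightarrow>
        (\<exists>s. pa_module_hom Q M E s \<and> (\<forall>x\<in>mcarrier M. g (s x) = x)))"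

text \<open>Vectors \<open>m\<close> with support in \<open>verts Q\<close> stand for \<open>\<Sum> m\<^sub>i \<alpha>\<^sub>i\<close>.\<close>

definition dim_vector :: "'b quiver \<Rightarrow> ('b, 'k::field) pa_module \<Rightarrow> nat \<Rightarrow> int" where
  "dim_vector Q M = (\<lambda>i. if i \<in> verts Q then int (pmv.dim (mact M (pa_idem i) ` mcarrier M)) else 0)"

definition real_Schur_roots :: "'k::alg_closed_field itself \<Rightarrow> 'b quiver \<Rightarrow> (nat \<Rightarrow> int) set" where
  "real_Schur_roots _ Q =
     {dim_vector Q M | M :: ('b, 'k) pa_module.
        is_pa_module Q M \<and> indecomposable Q M \<and> Ext1_zero Q M M}"

section \<open>The Weyl group\<close>

definition cartan :: "'b quiver \<Rightarrow> nat \<Rightarrow> nat \<Rightarrow> int" where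
  "cartan Q i j =
     (if i = j then 2 else - int (card {e \<in> arcs Q. {tail Q e, head Q e} = {i, j}}))"

definition simple_root :: "nat \<Rightarrow> nat \<Rightarrow> int" where
  "simple_root i = (\<lambda>k. if k = i then 1 else 0)"

text \<open>The linear map with \<open>\<alpha>\<^sub>j \<mapsto> \<alpha>\<^sub>j - a\<^sub>i\<^sub>j \<alpha>\<^sub>i\<close>; coordinates outside \<open>verts Q\<close> are left alone.\<close>

definition simple_refl :: "'b quiver \<Rightarrow> nat \<Rightarrow> (nat \<Rightarrow> int) \<Rightarrow> (nat \<Rightarrow> int)" where
  "simple_refl Q i v = (\<lambda>k. v k - (\<Sum>j\<in>verts Q. v j * cartan Q i j) * simple_root i k)"

definition word_prod :: "'b quiver \<Rightarrow> nat list \<Rightarrow> (nat \<Rightarrow> int) \<Rightarrow> (nat \<Rightarrow> int)" where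
  "word_prod Q ws = foldr (\<lambda>i f. simple_refl Q i \<circ> f) ws id"

text \<open>Simple reflections are involutions, so the group they generate consists of their products.\<close>

definition weyl_group :: "'b quiver \<Rightarrow> ((nat \<Rightarrow> int) \<Rightarrow> (nat \<Rightarrow> int)) set" where
  "weyl_group Q = {word_prod Q ws | ws. set ws \<subseteq> verts Q}"

definition reflections :: "'b quiver \<Rightarrow> ((nat \<Rightarrow> int) \<Rightarrow> (nat \<Rightarrow> int)) set" where
  "reflections Q = {w \<circ> simple_refl Q i \<circ> inv w | w i. w \<in> weyl_group Q \<and> i \<in> verts Q}"

definition root_of_reflection ::
    "'b quiver \<Rightarrow> ((nat \<Rightarrow> int) \<Rightarrow> (nat \<Rightarrow> int)) \<Rightarrow> nat \<Rightarrow> int" where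
  "root_of_reflection Q r = (THE b. (\<forall>k. 0 \<le> b k) \<and>
     (\<exists>w\<in>weyl_group Q. \<exists>i\<in>verts Q. b = w (simple_root i) \<and> r = w \<circ> simple_refl Q i \<circ> inv w))"

definition reduced_adj_words :: "'b quiver \<Rightarrow> nat list set" where
  "reduced_adj_words Q = {ws. set ws \<subseteq> verts Q \<and> distinct_adj ws}"

definition R_words_of :: "'b quiver \<Rightarrow> ((nat \<Rightarrow> int) \<Rightarrow> (nat \<Rightarrow> int)) \<Rightarrow> nat list set" where
  "R_words_of Q w = {ws \<in> reduced_adj_words Q. word_prod Q ws = w}"

definition R_words :: "'b quiver \<Rightarrow> nat list set" where
  "R_words Q = (\<Union>w\<in>reflections Q. R_words_of Q w)"

section \<open>The surfaces\<close>

definition quiver_perms :: "'b quiver \<Rightarrow> (nat \<Rightarrow> nat) set" where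
  "quiver_perms Q = {\<sigma>. \<sigma> permutes verts Q \<and>
     (\<forall>i\<in>verts Q. \<forall>j\<in>verts Q. j > i \<longrightarrow>
        \<not> (\<exists>e\<in>arcs Q. tail Q e = \<sigma> j \<and> head Q e = \<sigma> i))}"

text \<open>
  The regular \<open>N\<close>-gon has the \<open>N\<close>-th roots of unity as vertices; the bigon is the closed unit
  disc with its upper and lower half circles as edges.  The \<open>m\<close>-th edge (\<open>1 \<le> m \<le> N\<close>) runs
  counter-clockwise from vertex \<open>m - 1\<close> to vertex \<open>m\<close> and carries the label \<open>T\<close> with index \<open>\<sigma> m\<close>.
\<close>

definition gon_vertex :: "nat \<Rightarrow> nat \<Rightarrow> complex" where
  "gon_vertex N k = cis (2 * pi * real k / real N)"

definition gon :: "nat \<Rightarrow> complex set" where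
  "gon N = (if N \<le> 2 then cball 0 1 else convex hull (gon_vertex N ` {0..<N}))"

definition gon_edge :: "nat \<Rightarrow> nat \<Rightarrow> real \<Rightarrow> complex" where
  "gon_edge N m t =
     (if N \<le> 2 then cis (2 * pi * (real m - 1 + t) / real N)
      else of_real (1 - t) * gon_vertex N (m - 1) + of_real t * gon_vertex N m)"

text \<open>
  Points of the disjoint union of \<open>G\<^sub>1\<close> and \<open>G\<^sub>2\<close> are pairs \<open>(i, z)\<close> with \<open>i \<in> {1, 2}\<close>.  The edges
  are oriented counter-clockwise in \<open>G\<^sub>1\<close> and clockwise in \<open>G\<^sub>2\<close>, whence \<open>t\<close> is matched with \<open>1 - t\<close>.
\<close>

definition two_gons :: "nat \<Rightarrow> (nat \<times> complex) set" where
  "two_gons N = {1, 2} \<times> gon N"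

definition glue :: "nat \<Rightarrow> nat \<times> complex \<Rightarrow> nat \<times> complex \<Rightarrow> bool" where
  "glue N p q \<longleftrightarrow>
     (\<exists>m\<in>{1..N}. \<exists>t\<in>{0..1}. p = (1, gon_edge N m t) \<and> q = (2, gon_edge N m (1 - t)))"

definition surf_pt :: "nat \<Rightarrow> nat \<times> complex \<Rightarrow> (nat \<times> complex) set" where
  "surf_pt N p = {q. equivclp (glue N) p q}"

definition quotient_topology :: "'a topology \<Rightarrow> ('a \<Rightarrow> 'b) \<Rightarrow> 'b topology" where
  "quotient_topology X q =
     topology (\<lambda>U. U \<subseteq> q ` topspace X \<and> openin X {x \<in> topspace X. q x \<in> U})"

lemma openin_quotient_topology:
  "openin (quotient_topology X q) U \<longleftrightarrow>
     U \<subseteq> q ` topspace X \<and> openin X {x \<in> topspace X. q x \<in> U}"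
proof -
  have "istopology (\<lambda>U. U \<subseteq> q ` topspace X \<and> openin X {x \<in> topspace X. q x \<in> U})"
    unfolding istopology_def
  proof (intro conjI allI impI; (elim conjE)?)
    fix S T
    assume "S \<subseteq> q ` topspace X" "openin X {x \<in> topspace X. q x \<in> S}"
      "openin X {x \<in> topspace X. q x \<in> T}"
    moreover have "{x \<in> topspace X. q x \<in> S \<inter> T} =
        {x \<in> topspace X. q x \<in> S} \<inter> {x \<in> topspace X. q x \<in> T}"
      by blast
    ultimately show "S \<inter> T \<subseteq> q ` topspace X" "openin X {x \<in> topspace X. q x \<in> S \<inter> T}"
      by auto
  next
    fix K
    assume K: "\<forall>U\<in>K. U \<subseteq> q ` topspace X \<and> openin X {x \<in> topspace X. q x \<in> U}"
    then show "\<Union>K \<subseteq> q ` topspace X" by blast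
    have "{x \<in> topspace X. q x \<in> \<Union>K} = \<Union>((\<lambda>U. {x \<in> topspace X. q x \<in> U}) ` K)"
      by blast
    moreover have "openin X (\<Union>((\<lambda>U. {x \<in> topspace X. q x \<in> U}) ` K))"
      by (rule openin_Union) (use K in auto)
    ultimately show "openin X {x \<in> topspace X. q x \<in> \<Union>K}"
      by (simp only:)
  qed
  then show ?thesis
    by (simp add: quotient_topology_def topology_inverse')
qed

definition surface :: "nat \<Rightarrow> (nat \<times> complex) set topology" where
  "surface N = quotient_topology (top_of_set (two_gons N)) (surf_pt N)"

text \<open>As edges with the same label are identified, \<open>T\<^sub>i\<close> is the image of the edge of \<open>G\<^sub>1\<close> labelled \<open>T\<^sub>i\<close>.\<close>

definition T_edge :: "nat \<Rightarrow> (nat \<Rightarrow> nat) \<Rightarrow> nat \<Rightarrow> (nat \<times> complex) set set" where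
  "T_edge N \<sigma> i = {surf_pt N (1, gon_edge N m t) | m t. m \<in> {1..N} \<and> \<sigma> m = i \<and> t \<in> {0..1}}"

definition T_all :: "nat \<Rightarrow> (nat \<Rightarrow> nat) \<Rightarrow> (nat \<times> complex) set set" where
  "T_all N \<sigma> = (\<Union>i\<in>{1..N}. T_edge N \<sigma> i)"

definition V_pts :: "nat \<Rightarrow> (nat \<times> complex) set set" where
  "V_pts N = surf_pt N ` ({1, 2} \<times> gon_vertex N ` {0..<N})"

text \<open>Vertex \<open>0\<close> begins the edge labelled by \<open>\<sigma> 1\<close> and ends the edge labelled by \<open>\<sigma> N\<close>.\<close>

definition L_seg :: "nat \<Rightarrow> nat \<Rightarrow> (nat \<times> complex) set set" where
  "L_seg N i = surf_pt N ` ({i} \<times> closed_segment 0 (gon_vertex N 0))"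

definition face :: "nat \<Rightarrow> (nat \<Rightarrow> nat) \<Rightarrow> nat \<Rightarrow> (nat \<times> complex) set set" where
  "face N \<sigma> i = surf_pt N ` ({i} \<times> gon N) - T_all N \<sigma>"

section \<open>Admissible curves\<close>

text \<open>
  Transversality of a continuous curve to \<open>\<T>\<close> at a point of an open edge: near that
  parameter the curve meets \<open>\<T>\<close> only once and passes from one side of the edge to the other.
  The two sides of an edge are the interiors of \<open>G\<^sub>1\<close> and \<open>G\<^sub>2\<close>.
\<close>

definition crosses_transversally ::
    "nat \<Rightarrow> (nat \<Rightarrow> nat) \<Rightarrow> (real \<Rightarrow> (nat \<times> complex) set) \<Rightarrow> real \<Rightarrow> bool" where
  "crosses_transversally N \<sigma> \<eta> x \<longleftrightarrow>
     (\<exists>\<epsilon>>0. \<exists>a b. {a, b} = {1, 2} \<and> 0 \<le> x - \<epsilon> \<and> x + \<epsilon> \<le> 1 \<and>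
        \<eta> ` {x - \<epsilon>..<x} \<subseteq> face N \<sigma> a \<and> \<eta> ` {x<..x + \<epsilon>} \<subseteq> face N \<sigma> b)"

text \<open>
  The set of crossing times is finite for curves satisfying the other conditions of
  admissibility; on an infinite set \<open>sorted_list_of_set\<close> would give the empty word, which is
  not in \<open>R_words Q\<close>.
\<close>

definition crossing_word ::
    "nat \<Rightarrow> (nat \<Rightarrow> nat) \<Rightarrow> (real \<Rightarrow> (nat \<times> complex) set) \<Rightarrow> nat list" where
  "crossing_word N \<sigma> \<eta> =
     map (\<lambda>x. THE i. i \<in> {1..N} \<and> \<eta> x \<in> T_edge N \<sigma> i)
       (sorted_list_of_set {x \<in> {0<..<1}. \<eta> x \<in> T_all N \<sigma>})"

definition admissible_curve :: "'b quiver \<Rightarrow> (nat \<Rightarrow> nat) \<Rightarrow> (real \<Rightarrow> (nat \<times> complex) set) \<Rightarrow> bool" where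
  "admissible_curve Q \<sigma> \<eta> \<longleftrightarrow> (let N = card (verts Q) in
     pathin (surface N) \<eta> \<and>
     (\<forall>x\<in>{0..1}. \<eta> x \<in> V_pts N \<longleftrightarrow> x \<in> {0, 1}) \<and>
     (\<exists>\<epsilon>>0. \<epsilon> \<le> 1 \<and> \<eta> ` {0..\<epsilon>} \<subseteq> L_seg N 1 \<and> \<eta> ` {1 - \<epsilon>..1} \<subseteq> L_seg N 2) \<and>
     (\<forall>x\<in>{0..1}. \<eta> x \<in> T_all N \<sigma> - V_pts N \<longrightarrow> crosses_transversally N \<sigma> \<eta> x) \<and>
     crossing_word N \<sigma> \<eta> \<in> R_words Q)"

definition simple_admissible ::
    "'b quiver \<Rightarrow> (nat \<Rightarrow> nat) \<Rightarrow> (real \<Rightarrow> (nat \<times> complex) set) set" where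
  "simple_admissible Q \<sigma> = {\<eta>. admissible_curve Q \<sigma> \<eta> \<and>
     (\<forall>x\<in>{0..1}. \<forall>y\<in>{0..1}. \<eta> x = \<eta> y \<longrightarrow> x = y \<or> {x, y} = {0, 1})}"

definition curve_root ::
    "'b quiver \<Rightarrow> (nat \<Rightarrow> nat) \<Rightarrow> (real \<Rightarrow> (nat \<times> complex) set) \<Rightarrow> nat \<Rightarrow> int" where
  "curve_root Q \<sigma> \<eta> =
     root_of_reflection Q (word_prod Q (crossing_word (card (verts Q)) \<sigma> \<eta>))"

end

theory Submission
  imports Defs
begin

text \<open>
  Both sides of the theorem are the set of all vectors \<open>\<alpha>\<^sub>a + \<dots> + \<alpha>\<^sub>b\<close>, \<open>1 \<le> a \<le> b \<le> n\<close>.  Such a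
  vector is encoded by the pair \<open>(a, b + 1)\<close>; in general \<open>A_root a b\<close> stands for the difference
  \<open>\<epsilon>\<^sub>a - \<epsilon>\<^sub>b\<close> of two of \<open>n + 1\<close> unit vectors, on which the Weyl group acts by permuting indices.

  The root of any admissible curve is of this form because its word spells a reflection, the
  reflections are those along the \<open>A_root a b\<close>, and a reflection determines its positive root
  (\<open>curve_root_A_interval\<close>).

  For the converse, reflection along \<open>\<alpha>\<^sub>a + \<dots> + \<alpha>\<^sub>b\<close> is spelled by the palindrome
  \<open>a, a + 1, \<dots>, b, \<dots>, a + 1, a\<close> (\<open>palindrome_word\<close>).  The condition on \<open>\<sigma>\<close> forces every
  \<open>k\<close> to precede \<open>k + 1\<close>, so \<open>\<sigma>\<close> is the identity and the edges \<open>T\<^sub>1, \<dots>, T\<^sub>n\<close> follow each other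
  around the polygons.  Exchanging \<open>G\<^sub>1\<close> and \<open>G\<^sub>2\<close> point by point is compatible with the gluing
  and reverses each edge, fixing its midpoint.  It therefore suffices to draw an arc that crosses
  \<open>T\<^sub>a, \<dots>, T\<^sub>b\<^sub>-\<^sub>1\<close> and ends at the midpoint of \<open>T\<^sub>b\<close>, and to continue it by its mirror image, run
  backwards.  When all pieces of the arc are drawn in one and the same polygon, the first is the way
  from the initial vertex over the center to \<open>T\<^sub>a\<close> and each of the others cuts off one corner,
  running from \<open>T\<^sub>k\<close> to \<open>T\<^sub>k\<^sub>+\<^sub>1\<close>.  The arc leaves through the first half of each edge and comes back
  through the second half, so the pieces occupy disjoint angular sectors, and the curve has no
  self-intersection.  Locale \<open>zigzag\<close> carries this out in polar coordinates; \<open>polar_inj\<close> makes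
  them available on the polygon.

  On the side of modules, the interval modules are indecomposable because each nonzero submodule
  contains the line at the last vertex (\<open>interval_mod_indecomposable\<close>), and have no
  self-extensions because a lift of the generator obeys the relations that define them
  (\<open>interval_mod_Ext1_zero\<close>).  Conversely, an indecomposable module has the dimension vector of an
  interval module, since a vector at the first vertex of the support generates an interval module
  that is a direct summand (\<open>indecomposable_dim_vector\<close>).
\<close>

section \<open>Roots of type A\<close>

text \<open>
  The root \<open>\<epsilon>\<^sub>a - \<epsilon>\<^sub>b\<close> in coordinates with respect to the simple roots; for \<open>a < b\<close> it is
  \<open>\<alpha>\<^sub>a + \<dots> + \<alpha>\<^sub>b\<^sub>-\<^sub>1\<close>.
\<close>

definition A_root :: "nat \<Rightarrow> nat \<Rightarrow> nat \<Rightarrow> int" where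
  "A_root a b = (\<lambda>k. of_bool (a \<le> k) - of_bool (b \<le> k))"

lemma verts_A [simp]: "verts (equioriented_A n) = {1..n}"
  and arcs_A: "arcs (equioriented_A n) = {(i, Suc i) | i. 1 \<le> i \<and> i < n}"
  and tail_A [simp]: "tail (equioriented_A n) = fst"
  and head_A [simp]: "head (equioriented_A n) = snd"
  by (simp_all add: equioriented_A_def)

lemma simple_root_eq_A_root: "simple_root i = A_root i (Suc i)"
  by (auto simp: simple_root_def A_root_def fun_eq_iff)

lemma cartan_A:
  assumes "i \<in> {1..n}" "j \<in> {1..n}"
  shows "cartan (equioriented_A n) i j =
    2 * of_bool (j = i) - of_bool (Suc j = i) - of_bool (j = Suc i)"
proof -
  let ?S = "{e \<in> arcs (equioriented_A n). {fst e, snd e} = {i, j}}"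
  consider "i = j" | "j = Suc i" | "i = Suc j" | "i \<noteq> j" "j \<noteq> Suc i" "i \<noteq> Suc j" by blast
  then show ?thesis
  proof cases
    case 2
    then have "?S = {(i, j)}" using assms by (auto simp: arcs_A doubleton_eq_iff)
    then show ?thesis using 2 by (simp add: cartan_def)
  next
    case 3
    then have "?S = {(j, i)}" using assms by (auto simp: arcs_A doubleton_eq_iff)
    then show ?thesis using 3 by (simp add: cartan_def)
  next
    case 4
    then have "?S = {}" by (auto simp: arcs_A doubleton_eq_iff)
    then have "card ?S = 0" by (simp only: card.empty)
    then show ?thesis using 4 by (simp add: cartan_def)
  qed (simp add: cartan_def)
qed

lemma simple_refl_A:
  assumes i: "i \<in> {1..n}" and v: "v 0 = 0" "v (Suc n) = 0"
  shows "simple_refl (equioriented_A n) i v = v(i := v (i - 1) + v (Suc i) - v i)"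
proof -
  let ?c = "\<lambda>j. 2 * of_bool (j = i) - of_bool (j = i - 1) - of_bool (j = Suc i) :: int"
  have "(\<Sum>j\<in>{1..n}. v j * cartan (equioriented_A n) i j) = (\<Sum>j\<in>{1..n}. v j * ?c j)"
    using i by (intro sum.cong) (auto simp: cartan_A)
  also have "\<dots> = (\<Sum>j\<in>{0..Suc n}. v j * ?c j)"
  proof (rule sum.mono_neutral_left)
    show "\<forall>j\<in>{0..Suc n} - {1..n}. v j * ?c j = 0"
    proof
      fix j assume "j \<in> {0..Suc n} - {1..n}"
      then have "j = 0 \<or> j = Suc n" by auto
      then show "v j * ?c j = 0" using v by auto
    qed
  qed auto
  also have "\<dots> = (\<Sum>j\<in>{0..Suc n}. 2 * (if j = i then v j else 0) - (if j = i - 1 then v j else 0)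
      - (if j = Suc i then v j else 0))"
    by (intro sum.cong) (auto simp: algebra_simps)
  also have "\<dots> = 2 * v i - v (i - 1) - v (Suc i)"
    using i by (auto simp: sum_subtractf sum_distrib_left[symmetric] sum.delta)
  finally show ?thesis
    by (auto simp: simple_refl_def fun_eq_iff simple_root_def)
qed

text \<open>
  Reflection at \<open>i\<close> replaces the coordinate \<open>v\<^sub>i\<close> by \<open>v\<^sub>i\<^sub>-\<^sub>1 + v\<^sub>i\<^sub>+\<^sub>1 - v\<^sub>i\<close>, that is, exchanges the
  increments \<open>v\<^sub>i - v\<^sub>i\<^sub>-\<^sub>1\<close> and \<open>v\<^sub>i\<^sub>+\<^sub>1 - v\<^sub>i\<close>; the increments of a root are its entries at \<open>a\<close> and \<open>b\<close>.
\<close>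

lemma simple_refl_A_root:
  assumes "i \<in> {1..n}" "a \<in> {1..Suc n}" "b \<in> {1..Suc n}"
  shows "simple_refl (equioriented_A n) i (A_root a b) =
    A_root (Transposition.transpose i (Suc i) a) (Transposition.transpose i (Suc i) b)"
proof -
  have step: "(of_bool (Transposition.transpose i (Suc i) c \<le> k) :: int) =
     (if k = i then of_bool (c \<le> i - 1) + of_bool (c \<le> Suc i) - of_bool (c \<le> i) else of_bool (c \<le> k))"
    for c k using assms(1) by (auto simp: Transposition.transpose_def)
  have "simple_refl (equioriented_A n) i (A_root a b) =
      (A_root a b)(i := A_root a b (i - 1) + A_root a b (Suc i) - A_root a b i)"
    using assms by (intro simple_refl_A) (auto simp: A_root_def)
  also have "\<dots> = A_root (Transposition.transpose i (Suc i) a) (Transposition.transpose i (Suc i) b)"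
    by (auto simp: fun_eq_iff A_root_def step)
  finally show ?thesis .
qed

section \<open>Reflections and their roots\<close>

lemma word_prod_simps [simp]:
  "word_prod Q [] = id"
  "word_prod Q (i # ws) = simple_refl Q i \<circ> word_prod Q ws"
  by (simp_all add: word_prod_def)

lemma word_prod_append [simp]: "word_prod Q (us @ ws) = word_prod Q us \<circ> word_prod Q ws"
  by (induction us) (simp_all add: comp_assoc)

lemma simple_refl_linear:
  "simple_refl Q i (\<lambda>k. v k - c * u k) = (\<lambda>k. simple_refl Q i v k - c * simple_refl Q i u k)"
  by (simp add: simple_refl_def fun_eq_iff algebra_simps sum_subtractf sum_distrib_left sum.distrib)

lemma word_prod_linear:
  "word_prod Q ws (\<lambda>k. v k - c * u k) = (\<lambda>k. word_prod Q ws v k - c * word_prod Q ws u k)"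
  by (induction ws) (simp_all add: simple_refl_linear)

lemma sum_simple_root_cartan:
  assumes "finite (verts Q)" "i \<in> verts Q"
  shows "(\<Sum>j\<in>verts Q. simple_root i j * cartan Q i j) = 2"
proof -
  have "(\<Sum>j\<in>verts Q. simple_root i j * cartan Q i j) = (\<Sum>j\<in>verts Q. if j = i then 2 else 0)"
    by (intro sum.cong) (auto simp: simple_root_def cartan_def)
  then show ?thesis using assms by (simp add: sum.delta)
qed

lemma simple_refl_simple_root:
  assumes "finite (verts Q)" "i \<in> verts Q"
  shows "simple_refl Q i (simple_root i) = (\<lambda>k. - simple_root i k)"
  by (simp add: simple_refl_def sum_simple_root_cartan assms fun_eq_iff)

lemma simple_refl_involution:
  assumes "finite (verts Q)" "i \<in> verts Q"
  shows "simple_refl Q i \<circ> simple_refl Q i = id"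
proof
  fix v
  define c where "c = (\<Sum>j\<in>verts Q. v j * cartan Q i j)"
  have v: "simple_refl Q i v = (\<lambda>k. v k - c * simple_root i k)"
    by (simp add: simple_refl_def c_def)
  have "simple_refl Q i (simple_refl Q i v) =
      (\<lambda>k. simple_refl Q i v k - c * simple_refl Q i (simple_root i) k)"
    by (simp only: v simple_refl_linear)
  then show "(simple_refl Q i \<circ> simple_refl Q i) v = id v"
    by (simp add: v simple_refl_simple_root assms)
qed

lemma word_prod_rev:
  assumes "finite (verts Q)" "set ws \<subseteq> verts Q"
  shows "word_prod Q ws \<circ> word_prod Q (rev ws) = id"
  using assms(2)
proof (induction ws)
  case (Cons i ws)
  have eq: "word_prod Q (i # ws) \<circ> word_prod Q (rev (i # ws)) =
      simple_refl Q i \<circ> (word_prod Q ws \<circ> word_prod Q (rev ws)) \<circ> simple_refl Q i"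
    by (simp add: comp_assoc)
  have "word_prod Q ws \<circ> word_prod Q (rev ws) = id"
    by (rule Cons.IH) (use Cons.prems in simp)
  then show ?case using Cons.prems
    unfolding eq by (simp only: comp_id simple_refl_involution[OF assms(1)] set_simps insert_subset)
qed simp

lemma bij_word_prod:
  assumes "finite (verts Q)" "set ws \<subseteq> verts Q"
  shows "bij (word_prod Q ws)" and "inv (word_prod Q ws) = word_prod Q (rev ws)"
proof -
  have 1: "word_prod Q ws \<circ> word_prod Q (rev ws) = id" by (rule word_prod_rev[OF assms])
  have 2: "word_prod Q (rev ws) \<circ> word_prod Q ws = id"
    using word_prod_rev[of Q "rev ws"] assms by simp
  show "bij (word_prod Q ws)" using 1 2 by (metis o_bij)
  show "inv (word_prod Q ws) = word_prod Q (rev ws)" using 1 2 by (metis inv_unique_comp)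
qed

text \<open>
  What the map \<open>w s\<^sub>i w\<^sup>-\<^sup>1\<close> reveals about the root \<open>w \<alpha>\<^sub>i\<close>, expressed without \<open>w\<close> and \<open>i\<close> so that two
  factorizations of the same map can be compared.
\<close>

definition refl_along :: "(nat \<Rightarrow> int) \<Rightarrow> ((nat \<Rightarrow> int) \<Rightarrow> nat \<Rightarrow> int) \<Rightarrow> bool" where
  "refl_along b r \<longleftrightarrow> r b = (\<lambda>k. - b k) \<and> (\<forall>v. \<exists>c. r v = (\<lambda>k. v k - c * b k))"

lemma refl_along_conjugate:
  assumes fin: "finite (verts Q)" and w: "w \<in> weyl_group Q" and i: "i \<in> verts Q"
  shows "refl_along (w (simple_root i)) (w \<circ> simple_refl Q i \<circ> inv w)"
proof -
  obtain ws where ws: "w = word_prod Q ws" "set ws \<subseteq> verts Q"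
    using w by (auto simp: weyl_group_def)
  note bij = bij_word_prod(1)[OF fin ws(2), folded ws(1)]
  have lin: "w (\<lambda>k. v k - c * u k) = (\<lambda>k. w v k - c * w u k)" for v c u
    by (simp add: ws word_prod_linear)
  have zero: "w (\<lambda>k. 0) = (\<lambda>k. 0)"
    using lin[of "\<lambda>k. 0" 1 "\<lambda>k. 0"] by simp
  have "(w \<circ> simple_refl Q i \<circ> inv w) (w (simple_root i)) = w (\<lambda>k. 0 - 1 * simple_root i k)"
    using bij by (simp add: bij_is_inj simple_refl_simple_root fin i)
  also have "\<dots> = (\<lambda>k. - w (simple_root i) k)"
    by (simp only: lin zero) simp
  finally have 1: "(w \<circ> simple_refl Q i \<circ> inv w) (w (simple_root i)) = (\<lambda>k. - w (simple_root i) k)" .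
  have "\<exists>c. (w \<circ> simple_refl Q i \<circ> inv w) v = (\<lambda>k. v k - c * w (simple_root i) k)" for v
  proof -
    define c where "c = (\<Sum>j\<in>verts Q. inv w v j * cartan Q i j)"
    have "(w \<circ> simple_refl Q i \<circ> inv w) v = w (\<lambda>k. inv w v k - c * simple_root i k)"
      by (simp add: simple_refl_def c_def)
    also have "\<dots> = (\<lambda>k. v k - c * w (simple_root i) k)"
      using bij by (simp add: lin bij_is_surj surj_f_inv_f)
    finally show ?thesis by blast
  qed
  with 1 show ?thesis by (simp add: refl_along_def)
qed

lemma weyl_root_A:
  assumes "w \<in> weyl_group (equioriented_A n)" "i \<in> {1..n}"
  obtains a b where "a \<in> {1..Suc n}" "b \<in> {1..Suc n}" "a \<noteq> b" "w (simple_root i) = A_root a b"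
proof -
  obtain ws where ws: "w = word_prod (equioriented_A n) ws" "set ws \<subseteq> {1..n}"
    using assms by (auto simp: weyl_group_def)
  have "\<exists>a b. a \<in> {1..Suc n} \<and> b \<in> {1..Suc n} \<and> a \<noteq> b \<and>
      word_prod (equioriented_A n) ws (simple_root i) = A_root a b"
    using ws(2)
  proof (induction ws)
    case Nil
    show ?case using assms(2)
      by (intro exI[of _ i] exI[of _ "Suc i"]) (auto simp: simple_root_eq_A_root)
  next
    case (Cons j ws)
    then obtain a b where ab: "a \<in> {1..Suc n}" "b \<in> {1..Suc n}" "a \<noteq> b"
        "word_prod (equioriented_A n) ws (simple_root i) = A_root a b" by auto
    have j: "j \<in> {1..n}" using Cons.prems by simp
    let ?t = "Transposition.transpose j (Suc j)"
    have "?t a \<noteq> ?t b" using ab(3) by (metis transpose_involutory)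
    moreover have "?t a \<in> {1..Suc n}" "?t b \<in> {1..Suc n}"
      using ab j by (auto simp: Transposition.transpose_def)
    moreover have "word_prod (equioriented_A n) (j # ws) (simple_root i) = A_root (?t a) (?t b)"
      using ab j by (simp add: simple_refl_A_root)
    ultimately show ?case by blast
  qed
  then show ?thesis using that ws by blast
qed

lemma A_root_nonneg_iff: "(\<forall>k. 0 \<le> A_root a b k) \<longleftrightarrow> a \<le> b"
proof
  assume "\<forall>k. 0 \<le> A_root a b k"
  then have "0 \<le> A_root a b b" ..
  then show "a \<le> b" by (simp add: A_root_def of_bool_def split: if_splits)
next
  assume "a \<le> b"
  then show "\<forall>k. 0 \<le> A_root a b k" by (simp add: A_root_def)
qed

text \<open>
  If \<open>r\<close> is a reflection along both \<open>\<beta>\<close> and \<open>\<gamma>\<close>, then \<open>- \<gamma> = r \<gamma> = \<gamma> - e \<beta>\<close> makes the two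
  proportional, and positive roots have coordinates in \<open>{0, 1}\<close>.
\<close>

lemma refl_along_unique:
  assumes "refl_along (A_root a b) r" "refl_along (A_root c d) r" "a < b" "c < d"
  shows "A_root a b = A_root c d"
proof -
  obtain e where e: "r (A_root c d) = (\<lambda>k. A_root c d k - e * A_root a b k)"
    using assms(1) unfolding refl_along_def by blast
  have "r (A_root c d) k = - A_root c d k" for k
    using assms(2) by (simp add: refl_along_def)
  then have "A_root c d k - e * A_root a b k = - A_root c d k" for k
    unfolding e .
  then have *: "2 * A_root c d k = e * A_root a b k" for k
  proof -
    have "A_root c d k - e * A_root a b k = - A_root c d k" by fact
    then show ?thesis by linarith
  qed

  have "e * A_root a b c = 2" using *[of c] assms(4) by (simp add: A_root_def)
  then have "e = 2" using assms(3) by (auto simp: A_root_def of_bool_def split: if_splits)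
  show ?thesis
  proof
    fix k
    show "A_root a b k = A_root c d k" using *[of k] \<open>e = 2\<close> by simp
  qed
qed

lemma root_of_reflection_A:
  assumes w: "w \<in> weyl_group (equioriented_A n)" and i: "i \<in> {1..n}"
    and root: "w (simple_root i) = A_root a b" and ab: "a < b"
  shows "root_of_reflection (equioriented_A n) (w \<circ> simple_refl (equioriented_A n) i \<circ> inv w) = A_root a b"
  unfolding root_of_reflection_def
proof (rule the_equality)
  show "(\<forall>k. 0 \<le> A_root a b k) \<and> (\<exists>w'\<in>weyl_group (equioriented_A n). \<exists>j\<in>verts (equioriented_A n).
      A_root a b = w' (simple_root j) \<and> w \<circ> simple_refl (equioriented_A n) i \<circ> inv w =
      w' \<circ> simple_refl (equioriented_A n) j \<circ> inv w')"
    using assms unfolding A_root_nonneg_iff by (auto intro!: bexI[of _ w] bexI[of _ i])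
next
  fix \<beta> assume *: "(\<forall>k. 0 \<le> \<beta> k) \<and> (\<exists>w'\<in>weyl_group (equioriented_A n). \<exists>j\<in>verts (equioriented_A n).
      \<beta> = w' (simple_root j) \<and> w \<circ> simple_refl (equioriented_A n) i \<circ> inv w =
      w' \<circ> simple_refl (equioriented_A n) j \<circ> inv w')"
  then obtain w' j where w': "w' \<in> weyl_group (equioriented_A n)" "j \<in> {1..n}" "\<beta> = w' (simple_root j)"
    and eq: "w \<circ> simple_refl (equioriented_A n) i \<circ> inv w =
      w' \<circ> simple_refl (equioriented_A n) j \<circ> inv w'" by auto
  obtain c d where cd: "c \<noteq> d" "w' (simple_root j) = A_root c d"
    by (rule weyl_root_A[OF w'(1,2)])
  have \<beta>: "\<beta> = A_root c d" using cd w'(3) by simp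
  have "c < d" using conjunct1[OF *] cd(1) A_root_nonneg_iff[of c d] unfolding \<beta> by simp
  moreover have "refl_along \<beta> (w \<circ> simple_refl (equioriented_A n) i \<circ> inv w)"
    unfolding eq w'(3) by (rule refl_along_conjugate) (use w' in auto)
  moreover have "refl_along (A_root a b) (w \<circ> simple_refl (equioriented_A n) i \<circ> inv w)"
    unfolding root[symmetric] by (rule refl_along_conjugate) (use w i in auto)
  ultimately show "\<beta> = A_root a b" using refl_along_unique[of c d _ a b] ab unfolding \<beta> by blast
qed

lemma weyl_group_simple_refl:
  assumes "w \<in> weyl_group Q" "i \<in> verts Q"
  shows "w \<circ> simple_refl Q i \<in> weyl_group Q"
proof -
  obtain ws where "w = word_prod Q ws" "set ws \<subseteq> verts Q" using assms by (auto simp: weyl_group_def)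
  then have "w \<circ> simple_refl Q i = word_prod Q (ws @ [i])" "set (ws @ [i]) \<subseteq> verts Q"
    using assms by simp_all
  then show ?thesis unfolding weyl_group_def by blast
qed

text \<open>If \<open>w\<close> maps a simple root to a negative root, then \<open>w s\<^sub>i\<close> represents the same reflection
  by a positive one.\<close>

lemma root_of_reflection_A_interval:
  assumes "r \<in> reflections (equioriented_A n)"
  obtains a b where "1 \<le> a" "a < b" "b \<le> Suc n" "root_of_reflection (equioriented_A n) r = A_root a b"
proof -
  let ?s = "simple_refl (equioriented_A n)"
  obtain w i where w: "w \<in> weyl_group (equioriented_A n)" "i \<in> {1..n}" "r = w \<circ> ?s i \<circ> inv w"
    using assms by (auto simp: reflections_def)
  obtain a b where ab: "a \<in> {1..Suc n}" "b \<in> {1..Suc n}" "a \<noteq> b" "w (simple_root i) = A_root a b"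
    using weyl_root_A[OF w(1,2)] .
  show ?thesis
  proof (cases "a < b")
    case True
    then show ?thesis using that[of a b] root_of_reflection_A[OF w(1,2) ab(4) True] ab w(3) by auto
  next
    case False
    then have ba: "b < a" using ab by auto
    obtain ws where ws: "w = word_prod (equioriented_A n) ws" "set ws \<subseteq> {1..n}"
      using w by (auto simp: weyl_group_def)
    have inv: "?s i \<circ> ?s i = id" by (rule simple_refl_involution) (use w in auto)
    have bij: "bij w" using bij_word_prod(1)[of "equioriented_A n" ws] ws by simp
    have "(w \<circ> ?s i) (simple_root i) = w (\<lambda>k. (\<lambda>k. 0) k - 1 * simple_root i k)"
      using w by (simp add: simple_refl_simple_root)
    also have "\<dots> = (\<lambda>k. w (\<lambda>k. 0) k - w (simple_root i) k)"
      by (simp only: ws word_prod_linear) simp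
    also have "w (\<lambda>k. 0) = (\<lambda>k. 0)"
      using word_prod_linear[of "equioriented_A n" ws "\<lambda>k. 0" 1 "\<lambda>k. 0"] by (simp add: ws)
    finally have root: "(w \<circ> ?s i) (simple_root i) = A_root b a"
      by (simp add: ab A_root_def fun_eq_iff)
    have bs: "bij (?s i)" using inv by (metis o_bij)
    have "inv (?s i) = ?s i" using inv by (metis inv_unique_comp)
    then have "inv (w \<circ> ?s i) = ?s i \<circ> inv w" using bij bs by (simp add: o_inv_distrib)
    then have "(w \<circ> ?s i) \<circ> ?s i \<circ> inv (w \<circ> ?s i) = w \<circ> (?s i \<circ> ?s i) \<circ> ?s i \<circ> inv w"
      by (simp add: comp_assoc)
    then have r: "r = (w \<circ> ?s i) \<circ> ?s i \<circ> inv (w \<circ> ?s i)" using inv w by simp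
    have "root_of_reflection (equioriented_A n) r = A_root b a"
      unfolding r using weyl_group_simple_refl[of w "equioriented_A n" i] w
      by (intro root_of_reflection_A[where w = "w \<circ> ?s i", OF _ w(2) root ba]) simp
    then show ?thesis using that[of b a] ab ba by auto
  qed
qed

lemma word_prod_upt_root:
  assumes "i \<le> j" "1 \<le> i" "j \<le> n"
  shows "word_prod (equioriented_A n) [i..<j] (simple_root j) = A_root i (Suc j)"
  using assms(1,2)
proof (induction i rule: inc_induct)
  case base
  show ?case by (simp add: simple_root_eq_A_root)
next
  case (step k)
  have "word_prod (equioriented_A n) [k..<j] (simple_root j) =
      simple_refl (equioriented_A n) k (A_root (Suc k) (Suc j))"
    using step by (simp add: upt_conv_Cons)
  also have "\<dots> = A_root k (Suc j)"
    using step assms by (subst simple_refl_A_root) auto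
  finally show ?case .
qed

text \<open>
  The letter \<open>j\<close> in the middle is conjugated by the prefix, which carries \<open>\<alpha>\<^sub>j\<close> to
  \<open>\<alpha>\<^sub>i + \<dots> + \<alpha>\<^sub>j\<close>.
\<close>

lemma palindrome_word:
  assumes "1 \<le> i" "i \<le> j" "j \<le> n"
  defines "ws \<equiv> [i..<j] @ [j] @ rev [i..<j]"
  shows "ws \<in> R_words (equioriented_A n)"
    and "root_of_reflection (equioriented_A n) (word_prod (equioriented_A n) ws) = A_root i (Suc j)"
proof -
  let ?w = "word_prod (equioriented_A n) [i..<j]"
  have w: "?w \<in> weyl_group (equioriented_A n)"
    using assms by (auto simp: weyl_group_def intro!: exI[of _ "[i..<j]"])
  have inv: "inv ?w = word_prod (equioriented_A n) (rev [i..<j])"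
    by (rule bij_word_prod) (use assms in auto)
  have prod: "word_prod (equioriented_A n) ws = ?w \<circ> simple_refl (equioriented_A n) j \<circ> inv ?w"
    by (simp add: ws_def inv comp_assoc)
  have upt: "distinct_adj ([i..<j] @ [j])"
    using assms by (simp add: distinct_adj_altdef remdups_adj_distinct)
  have "distinct_adj ws"
  proof (cases "i = j")
    case False
    then have "last [i..<j] \<noteq> j" "[i..<j] \<noteq> []" "distinct_adj [i..<j]"
      using assms by (auto simp: distinct_adj_altdef remdups_adj_distinct)
    then show ?thesis using False assms
      by (auto simp: ws_def distinct_adj_append_iff distinct_adj_Cons hd_rev)
  qed (simp add: ws_def)
  then have "ws \<in> reduced_adj_words (equioriented_A n)"
    using assms by (auto simp: reduced_adj_words_def)
  moreover have "word_prod (equioriented_A n) ws \<in> reflections (equioriented_A n)"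
    unfolding prod reflections_def using w assms by fastforce
  ultimately show "ws \<in> R_words (equioriented_A n)"
    by (auto simp: R_words_def R_words_of_def)
  show "root_of_reflection (equioriented_A n) (word_prod (equioriented_A n) ws) = A_root i (Suc j)"
    unfolding prod by (rule root_of_reflection_A[OF w]) (use assms word_prod_upt_root in auto)
qed

section \<open>Modules over the path algebra of type A\<close>

text \<open>
  The linear quiver has exactly one path from \<open>u\<close> to \<open>v\<close> if \<open>u \<le> v\<close>, and none otherwise.
\<close>

definition line_path :: "nat \<Rightarrow> nat \<Rightarrow> (nat \<times> nat) qpath" where
  "line_path u v = (u, map (\<lambda>i. (i, Suc i)) [u..<v], v)"

lemma cas_A:
  assumes "pre_digraph.cas (equioriented_A n) u p v" "set p \<subseteq> arcs (equioriented_A n)" "u \<in> {1..n}"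
  shows "u \<le> v \<and> v \<le> n \<and> p = map (\<lambda>i. (i, Suc i)) [u..<v]"
  using assms
proof (induction p arbitrary: u)
  case Nil
  then show ?case by (simp add: pre_digraph.cas.simps)
next
  case (Cons e p)
  then have e: "e = (u, Suc u)" "Suc u \<le> n" "pre_digraph.cas (equioriented_A n) (Suc u) p v"
    by (auto simp: pre_digraph.cas.simps arcs_A)
  then have "Suc u \<le> v \<and> v \<le> n \<and> p = map (\<lambda>i. (i, Suc i)) [Suc u..<v]"
    using Cons.IH[of "Suc u"] Cons.prems by auto
  then show ?case using e by (auto simp: upt_conv_Cons)
qed

lemma cas_line_path:
  assumes "u \<le> v"
  shows "pre_digraph.cas (equioriented_A n) u (map (\<lambda>i. (i, Suc i)) [u..<v]) v"
  using assms
  by (induction rule: inc_induct) (simp_all add: pre_digraph.cas.simps upt_conv_Cons)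

lemma qpaths_A: "qpaths (equioriented_A n) = {line_path u v | u v. 1 \<le> u \<and> u \<le> v \<and> v \<le> n}"
proof (intro equalityI subsetI)
  fix q assume "q \<in> qpaths (equioriented_A n)"
  then obtain u p v where q: "q = (u, p, v)" "pre_digraph.awalk (equioriented_A n) u p v"
    by (auto simp: qpaths_def)
  then have "u \<in> {1..n}" "u \<le> v \<and> v \<le> n \<and> p = map (\<lambda>i. (i, Suc i)) [u..<v]"
    using cas_A[of n u p v] by (auto simp: pre_digraph.awalk_def)
  then show "q \<in> {line_path u v | u v. 1 \<le> u \<and> u \<le> v \<and> v \<le> n}"
    using q by (auto simp: line_path_def)
next
  fix q assume "q \<in> {line_path u v | u v. 1 \<le> u \<and> u \<le> v \<and> v \<le> n}"
  then show "q \<in> qpaths (equioriented_A n)"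
    using cas_line_path by (auto simp: qpaths_def pre_digraph.awalk_def line_path_def arcs_A)
qed

lemma path_mult_line_path:
  assumes "u \<le> k'" "k \<le> v"
  shows "path_mult (line_path k v) (line_path u k') = (if k = k' then Poly_Mapping.single (line_path u v) 1 else 0)"
proof (cases "k = k'")
  case True
  have "[u..<k] @ [k..<v] = [u..<v]"
    using assms True by (metis le_Suc_ex upt_add_eq_append)
  then show ?thesis using True by (simp add: path_mult_def line_path_def flip: map_append)
qed (simp add: path_mult_def line_path_def)

definition path_elt :: "nat \<Rightarrow> nat \<Rightarrow> (nat \<times> nat) qpath \<Rightarrow>\<^sub>0 'k::field" where
  "path_elt u v = Poly_Mapping.single (line_path u v) 1"

lemma path_elt_carrier: "1 \<le> u \<Longrightarrow> u \<le> v \<Longrightarrow> v \<le> n \<Longrightarrow> path_elt u v \<in> pa_carrier (equioriented_A n)"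
  by (auto simp: pa_carrier_def path_elt_def qpaths_A)

lemma pa_idem_eq_path_elt: "pa_idem i = path_elt i i"
  by (simp add: pa_idem_def path_elt_def line_path_def)

lemma pa_mult_single:
  "pa_mult (Poly_Mapping.single p 1) (Poly_Mapping.single q 1) = path_mult p q"
  by (simp add: pa_mult_def)

lemma pa_mult_path_elt:
  assumes "u \<le> k'" "k \<le> v"
  shows "pa_mult (path_elt k v) (path_elt u k') = (if k = k' then path_elt u v else 0)"
  by (simp add: path_elt_def pa_mult_single path_mult_line_path assms)

subsection \<open>Linear extension\<close>

text \<open>
  An element of the path algebra acts by the linear extension of the action of paths.  Hence
  submodules, homomorphisms and the module axioms need to be examined on paths only
  (\<open>submoduleI\<close>, \<open>homI\<close>).
\<close>

definition linext :: "('p \<Rightarrow> (nat \<Rightarrow>\<^sub>0 'k::field)) \<Rightarrow> ('p \<Rightarrow>\<^sub>0 'k) \<Rightarrow> (nat \<Rightarrow>\<^sub>0 'k)" where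
  "linext F c = (\<Sum>p\<in>Poly_Mapping.keys c. scl (Poly_Mapping.lookup c p) (F p))"

lemma linext_superset:
  assumes "finite K" "Poly_Mapping.keys c \<subseteq> K"
  shows "linext F c = (\<Sum>p\<in>K. scl (Poly_Mapping.lookup c p) (F p))"
  unfolding linext_def using assms
  by (intro sum.mono_neutral_left) (auto simp: in_keys_iff)

lemma linext_add: "linext F (c + d) = linext F c + linext F d"
proof -
  let ?K = "Poly_Mapping.keys c \<union> Poly_Mapping.keys d"
  have "linext F (c + d) = (\<Sum>p\<in>?K. scl (Poly_Mapping.lookup (c + d) p) (F p))"
    by (rule linext_superset) (use Poly_Mapping.keys_add[of c d] in auto)
  also have "\<dots> = (\<Sum>p\<in>?K. scl (Poly_Mapping.lookup c p) (F p)) + (\<Sum>p\<in>?K. scl (Poly_Mapping.lookup d p) (F p))"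
    by (simp add: lookup_add pmv.scale_left_distrib sum.distrib)
  also have "\<dots> = linext F c + linext F d"
    by (subst (1 2) linext_superset[of ?K]) auto
  finally show ?thesis .
qed

lemma linext_scl: "linext F (scl r c) = scl r (linext F c)"
proof -
  have "linext F (scl r c) = (\<Sum>p\<in>Poly_Mapping.keys c. scl (Poly_Mapping.lookup (scl r c) p) (F p))"
    by (rule linext_superset) (auto simp: in_keys_iff)
  then show ?thesis by (simp add: linext_def pmv.scale_sum_right)
qed

lemma linext_0 [simp]: "linext F 0 = 0"
  by (simp add: linext_def)

lemma linext_single [simp]: "linext F (Poly_Mapping.single p 1) = F p"
  by (simp add: linext_def)

lemma linext_sum: "linext F (sum c A) = (\<Sum>i\<in>A. linext F (c i))"
  by (induction A rule: infinite_finite_induct) (simp_all add: linext_add)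

lemma linext_pa_mult:
  "linext F (pa_mult c d) = (\<Sum>p\<in>Poly_Mapping.keys c. \<Sum>q\<in>Poly_Mapping.keys d.
     scl (Poly_Mapping.lookup c p * Poly_Mapping.lookup d q) (linext F (path_mult p q)))"
  by (simp add: pa_mult_def linext_sum linext_scl)

lemma single_decomposition:
  "c = (\<Sum>p\<in>Poly_Mapping.keys c. scl (Poly_Mapping.lookup c p) (Poly_Mapping.single p (1 :: 'k::field)))"
proof (rule poly_mapping_eqI)
  fix q
  have "(\<Sum>p\<in>Poly_Mapping.keys c. Poly_Mapping.lookup c p * (1 when p = q)) =
      (\<Sum>p\<in>Poly_Mapping.keys c. if p = q then Poly_Mapping.lookup c q else 0)"
    by (intro sum.cong) (auto simp: when_def)
  then show "Poly_Mapping.lookup c q =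
    Poly_Mapping.lookup (\<Sum>p\<in>Poly_Mapping.keys c. scl (Poly_Mapping.lookup c p) (Poly_Mapping.single p 1)) q"
    by (simp add: lookup_sum lookup_single sum.delta in_keys_iff)
qed

subsection \<open>Modules given by their paths\<close>

abbreviation path_act :: "(nat \<times> nat, 'k::field) pa_module \<Rightarrow> nat \<Rightarrow> nat \<Rightarrow> (nat \<Rightarrow>\<^sub>0 'k) \<Rightarrow> (nat \<Rightarrow>\<^sub>0 'k)" where
  "path_act M u v \<equiv> mact M (path_elt u v)"

lemma pa_carrier_subspace: "pmv.subspace (pa_carrier (Q :: 'a quiver) :: ('a qpath \<Rightarrow>\<^sub>0 'b::field) set)"
proof (rule pmv.subspaceI)
  fix x y :: "'a qpath \<Rightarrow>\<^sub>0 'b" assume "x \<in> pa_carrier Q" "y \<in> pa_carrier Q"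
  then show "x + y \<in> pa_carrier Q"
    using Poly_Mapping.keys_add[of x y] by (auto simp: pa_carrier_def)
qed (auto simp: pa_carrier_def in_keys_iff subset_iff)

context
  fixes n :: nat and M :: "(nat \<times> nat, 'k::field) pa_module"
  assumes M: "is_pa_module (equioriented_A n) M"
begin

lemma carrier_subspace: "pmv.subspace (mcarrier M)"
  and act_closed: "\<And>c x. c \<in> pa_carrier (equioriented_A n) \<Longrightarrow> x \<in> mcarrier M \<Longrightarrow> mact M c x \<in> mcarrier M"
  and act_add_right: "\<And>c x y. c \<in> pa_carrier (equioriented_A n) \<Longrightarrow> x \<in> mcarrier M \<Longrightarrow> y \<in> mcarrier M \<Longrightarrow>
    mact M c (x + y) = mact M c x + mact M c y"
  and act_add_left: "\<And>c d x. c \<in> pa_carrier (equioriented_A n) \<Longrightarrow> d \<in> pa_carrier (equioriented_A n) \<Longrightarrow>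
    x \<in> mcarrier M \<Longrightarrow> mact M (c + d) x = mact M c x + mact M d x"
  and act_scl_left: "\<And>c r x. c \<in> pa_carrier (equioriented_A n) \<Longrightarrow> x \<in> mcarrier M \<Longrightarrow>
    mact M (scl r c) x = scl r (mact M c x)"
  and act_scl_right: "\<And>c r x. c \<in> pa_carrier (equioriented_A n) \<Longrightarrow> x \<in> mcarrier M \<Longrightarrow>
    mact M c (scl r x) = scl r (mact M c x)"
  and act_mult: "\<And>c d x. c \<in> pa_carrier (equioriented_A n) \<Longrightarrow> d \<in> pa_carrier (equioriented_A n) \<Longrightarrow>
    x \<in> mcarrier M \<Longrightarrow> mact M (pa_mult c d) x = mact M c (mact M d x)"
  and act_one: "\<And>x. x \<in> mcarrier M \<Longrightarrow> mact M (pa_one (equioriented_A n)) x = x"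
  using M unfolding is_pa_module_def by blast+

lemma act_0_left:
  assumes "x \<in> mcarrier M" shows "mact M 0 x = 0"
proof -
  have "mact M (0 + 0) x = mact M 0 x + mact M 0 x"
    by (rule act_add_left) (simp_all add: assms pmv.subspace_0[OF pa_carrier_subspace])
  then show ?thesis by (simp only: add_0 add_cancel_right_right)
qed

lemma act_0_right:
  assumes "c \<in> pa_carrier (equioriented_A n)" shows "mact M c 0 = 0"
proof -
  have "mact M c (0 + 0) = mact M c 0 + mact M c 0"
    by (rule act_add_right) (simp_all add: assms pmv.subspace_0[OF carrier_subspace])
  then show ?thesis by (simp only: add_0 add_cancel_right_right)
qed

lemma act_sum_left:
  assumes "\<And>i. i \<in> A \<Longrightarrow> c i \<in> pa_carrier (equioriented_A n)" "x \<in> mcarrier M"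
  shows "mact M (sum c A) x = (\<Sum>i\<in>A. mact M (c i) x)"
  using assms(1)
  by (induction A rule: infinite_finite_induct)
    (simp_all add: act_0_left act_add_left assms(2) pmv.subspace_sum[OF pa_carrier_subspace])

lemma act_sum_right:
  assumes "\<And>i. i \<in> A \<Longrightarrow> x i \<in> mcarrier M" "c \<in> pa_carrier (equioriented_A n)"
  shows "mact M c (sum x A) = (\<Sum>i\<in>A. mact M c (x i))"
  using assms(1)
  by (induction A rule: infinite_finite_induct)
    (simp_all add: act_0_right act_add_right assms(2) pmv.subspace_sum[OF carrier_subspace])

lemma act_linext:
  assumes "c \<in> pa_carrier (equioriented_A n)" "x \<in> mcarrier M"
  shows "mact M c x = linext (\<lambda>p. mact M (Poly_Mapping.single p 1) x) c"
proof -
  have p: "Poly_Mapping.single p 1 \<in> pa_carrier (equioriented_A n)" if "p \<in> Poly_Mapping.keys c" for p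
    using that assms by (auto simp: pa_carrier_def)
  have "mact M c x = mact M (\<Sum>p\<in>Poly_Mapping.keys c. scl (Poly_Mapping.lookup c p) (Poly_Mapping.single p 1)) x"
    by (simp flip: single_decomposition)
  also have "\<dots> = (\<Sum>p\<in>Poly_Mapping.keys c.
      mact M (scl (Poly_Mapping.lookup c p) (Poly_Mapping.single p 1)) x)"
    by (rule act_sum_left) (use p assms pmv.subspace_scale[OF pa_carrier_subspace] in blast)+
  also have "\<dots> = linext (\<lambda>p. mact M (Poly_Mapping.single p 1) x) c"
    unfolding linext_def by (intro sum.cong refl act_scl_left p assms(2))
  finally show ?thesis .
qed

lemma path_act_closed: "1 \<le> u \<Longrightarrow> u \<le> v \<Longrightarrow> v \<le> n \<Longrightarrow> x \<in> mcarrier M \<Longrightarrow> path_act M u v x \<in> mcarrier M"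
  using act_closed path_elt_carrier by blast

lemma path_act_path_act:
  assumes "1 \<le> u" "u \<le> k'" "k' \<le> n" "1 \<le> k" "k \<le> v" "v \<le> n" "x \<in> mcarrier M"
  shows "path_act M k v (path_act M u k' x) = (if k = k' then path_act M u v x else 0)"
  using assms by (simp add: act_mult[symmetric] path_elt_carrier pa_mult_path_elt act_0_left)

lemma sum_pact_idem:
  assumes "x \<in> mcarrier M"
  shows "(\<Sum>i\<in>{1..n}. path_act M i i x) = x"
proof -
  have "(\<Sum>i\<in>{1..n}. path_act M i i x) = mact M (pa_one (equioriented_A n)) x"
    unfolding pa_one_def pa_idem_eq_path_elt verts_A
    by (rule act_sum_left[symmetric]) (use path_elt_carrier assms in auto)
  then show ?thesis using act_one assms by simp
qed

lemma submoduleI: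
  assumes "S \<subseteq> mcarrier M" "pmv.subspace S"
    and "\<And>u v x. 1 \<le> u \<Longrightarrow> u \<le> v \<Longrightarrow> v \<le> n \<Longrightarrow> x \<in> S \<Longrightarrow> path_act M u v x \<in> S"
  shows "is_submodule (equioriented_A n) M S"
  unfolding is_submodule_def
proof (intro conjI ballI)
  fix c :: "(nat \<times> nat) qpath \<Rightarrow>\<^sub>0 'k" and x
  assume c: "c \<in> pa_carrier (equioriented_A n)" and x: "x \<in> S"
  have "mact M (Poly_Mapping.single p 1) x \<in> S" if "p \<in> Poly_Mapping.keys c" for p
    using that c x assms(3) by (auto simp: pa_carrier_def qpaths_A path_elt_def)
  then have "linext (\<lambda>p. mact M (Poly_Mapping.single p 1) x) c \<in> S"
    unfolding linext_def using assms(2) by (intro pmv.subspace_sum pmv.subspace_scale)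
  then show "mact M c x \<in> S" using act_linext[OF c] x assms(1) by auto
qed (use assms in auto)

end

lemma hom_scl:
  fixes M L :: "(nat \<times> nat, 'k::field) pa_module"
  assumes "is_pa_module (equioriented_A n) M" "is_pa_module (equioriented_A n) L"
    and "pa_module_hom (equioriented_A n) M L f" "x \<in> mcarrier M"
  shows "f (scl r x) = scl r (f x)"
proof -
  have one: "(pa_one (equioriented_A n) :: _ \<Rightarrow>\<^sub>0 'k) \<in> pa_carrier (equioriented_A n)"
    unfolding pa_one_def pa_idem_eq_path_elt verts_A
    by (intro pmv.subspace_sum[OF pa_carrier_subspace] path_elt_carrier) auto
  then have r: "scl r (pa_one (equioriented_A n)) \<in> pa_carrier (equioriented_A n)"
    using pmv.subspace_scale[OF pa_carrier_subspace] by blast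
  have fx: "f x \<in> mcarrier L" using assms(3,4) by (auto simp: pa_module_hom_def)
  have "f (mact M (scl r (pa_one (equioriented_A n))) x) = mact L (scl r (pa_one (equioriented_A n))) (f x)"
    using assms(3,4) r by (auto simp: pa_module_hom_def)
  then show ?thesis
    using one fx assms(4)
    by (simp add: act_scl_left[OF assms(1)] act_scl_left[OF assms(2)] act_one[OF assms(1)] act_one[OF assms(2)])
qed

lemma hom_0:
  assumes "is_pa_module (equioriented_A n) M" "pa_module_hom (equioriented_A n) M L f"
  shows "f 0 = 0"
proof -
  have "0 \<in> mcarrier M" using pmv.subspace_0[OF carrier_subspace] assms(1) by blast
  then have "f (0 + 0) = f 0 + f 0" using assms(2) unfolding pa_module_hom_def by blast
  then show ?thesis by (simp only: add_0 add_cancel_right_right)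
qed

lemma hom_sum:
  assumes "is_pa_module (equioriented_A n) M" "pa_module_hom (equioriented_A n) M L f"
    and "\<And>i. i \<in> A \<Longrightarrow> x i \<in> mcarrier M"
  shows "f (sum x A) = (\<Sum>i\<in>A. f (x i))"
  using assms(3)
proof (induction A rule: infinite_finite_induct)
  case (insert a A)
  then have "sum x A \<in> mcarrier M"
    by (intro pmv.subspace_sum[OF carrier_subspace[OF assms(1)]]) auto
  then have "f (x a + sum x A) = f (x a) + f (sum x A)"
    using assms(2) insert.prems unfolding pa_module_hom_def by blast
  then show ?case using insert by simp
qed (simp_all add: hom_0[OF assms(1,2)])

lemma homI:
  fixes M L :: "(nat \<times> nat, 'k::field) pa_module"
  assumes M: "is_pa_module (equioriented_A n) M" and L: "is_pa_module (equioriented_A n) L"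
    and "\<And>x. x \<in> mcarrier M \<Longrightarrow> f x \<in> mcarrier L"
    and add: "\<And>x y. x \<in> mcarrier M \<Longrightarrow> y \<in> mcarrier M \<Longrightarrow> f (x + y) = f x + f y"
    and scl: "\<And>r x. x \<in> mcarrier M \<Longrightarrow> f (scl r x) = scl r (f x)"
    and act: "\<And>u v x. 1 \<le> u \<Longrightarrow> u \<le> v \<Longrightarrow> v \<le> n \<Longrightarrow> x \<in> mcarrier M \<Longrightarrow> f (path_act M u v x) = path_act L u v (f x)"
  shows "pa_module_hom (equioriented_A n) M L f"
  unfolding pa_module_hom_def
proof (intro conjI ballI)
  fix c :: "(nat \<times> nat) qpath \<Rightarrow>\<^sub>0 'k" and x
  assume c: "c \<in> pa_carrier (equioriented_A n)" and x: "x \<in> mcarrier M"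
  have p: "mact M (Poly_Mapping.single p 1) x \<in> mcarrier M"
     "f (mact M (Poly_Mapping.single p 1) x) = mact L (Poly_Mapping.single p 1) (f x)"
    if "p \<in> Poly_Mapping.keys c" for p
    using that c x act path_act_closed[OF M] by (auto simp: pa_carrier_def qpaths_A path_elt_def)
  have f0: "f 0 = 0" using scl[OF x, of 0] by simp
  have sum: "f (sum y A) = (\<Sum>i\<in>A. f (y i))" if "\<And>i. i \<in> A \<Longrightarrow> y i \<in> mcarrier M" for y :: "_ \<Rightarrow> _" and A
    using that
    by (induction A rule: infinite_finite_induct)
      (auto simp: f0 add pmv.subspace_sum[OF carrier_subspace[OF M]])
  have "f (mact M c x) = (\<Sum>q\<in>Poly_Mapping.keys c. f (scl (Poly_Mapping.lookup c q) (mact M (Poly_Mapping.single q 1) x)))"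
    unfolding act_linext[OF M c x] linext_def
    by (rule sum) (use p pmv.subspace_scale[OF carrier_subspace[OF M]] in auto)
  also have "\<dots> = (\<Sum>q\<in>Poly_Mapping.keys c. scl (Poly_Mapping.lookup c q) (mact L (Poly_Mapping.single q 1) (f x)))"
    using p scl by simp
  also have "\<dots> = mact L c (f x)"
    using act_linext[OF L c] assms(3)[OF x] by (simp add: linext_def)
  finally show "f (mact M c x) = mact L c (f x)" .
qed (use assms in auto)

section \<open>Interval modules\<close>

text \<open>
  The interval module has one basis vector for each vertex in \<open>{a..b}\<close>, the unit vector with the
  same index, and a path inside the interval maps the basis vector at its start to that at its end.
\<close>

definition interval_act :: "nat \<Rightarrow> nat \<Rightarrow> (nat \<Rightarrow>\<^sub>0 'k::field) \<Rightarrow> (nat \<times> nat) qpath \<Rightarrow> (nat \<Rightarrow>\<^sub>0 'k)" where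
  "interval_act a b x p = (case p of (u, xs, v) \<Rightarrow>
     if u \<in> {a..b} \<and> v \<in> {a..b} then Poly_Mapping.single v (Poly_Mapping.lookup x u) else 0)"

definition interval_mod :: "nat \<Rightarrow> nat \<Rightarrow> (nat \<times> nat, 'k::field) pa_module" where
  "interval_mod a b = \<lparr>mcarrier = {x. Poly_Mapping.keys x \<subseteq> {a..b}}, mact = (\<lambda>c x. linext (interval_act a b x) c)\<rparr>"

lemma mem_interval_mod: "x \<in> mcarrier (interval_mod a b) \<longleftrightarrow> (\<forall>k. k \<notin> {a..b} \<longrightarrow> Poly_Mapping.lookup x k = 0)"
  by (auto simp: interval_mod_def in_keys_iff subset_iff)

lemma interval_mod_subspace: "pmv.subspace (mcarrier (interval_mod a b))"
  by (rule pmv.subspaceI) (auto simp: mem_interval_mod lookup_add)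

lemma interval_act_mem: "interval_act a b x p \<in> mcarrier (interval_mod a b)"
  by (auto simp: mem_interval_mod interval_act_def lookup_single when_def split: prod.splits)

lemma interval_act_add: "interval_act a b (x + y) p = interval_act a b x p + interval_act a b y p"
  by (auto simp: interval_act_def lookup_add single_add split: prod.splits)

lemma interval_act_scl: "interval_act a b (scl r x) p = scl r (interval_act a b x p)"
  by (auto simp: interval_act_def split: prod.splits intro!: poly_mapping_eqI simp: lookup_single when_def)

lemma interval_act_0: "interval_act a b 0 p = 0"
  by (auto simp: interval_act_def split: prod.splits)

lemma interval_act_sum: "interval_act a b (sum x A) p = (\<Sum>i\<in>A. interval_act a b (x i) p)"
  by (induction A rule: infinite_finite_induct) (simp_all add: interval_act_0 interval_act_add)

lemma path_act_interval_mod: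
  "path_act (interval_mod a b) u v x =
    (if u \<in> {a..b} \<and> v \<in> {a..b} then Poly_Mapping.single v (Poly_Mapping.lookup x u) else 0)"
  by (simp add: interval_mod_def path_elt_def interval_act_def line_path_def)

lemma interval_act_line_path:
  "interval_act a b x (line_path u v) =
    (if u \<in> {a..b} \<and> v \<in> {a..b} then Poly_Mapping.single v (Poly_Mapping.lookup x u) else 0)"
  by (simp add: interval_act_def line_path_def)

lemma interval_act_path_mult:
  assumes "p \<in> qpaths (equioriented_A n)" "q \<in> qpaths (equioriented_A n)"
  shows "linext (interval_act a b x) (path_mult p q) = interval_act a b (interval_act a b x q) p"
proof -
  obtain k v u k' where "p = line_path k v" "q = line_path u k'" "k \<le> v" "u \<le> k'"
    using assms by (auto simp: qpaths_A)
  then show ?thesis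
    by (cases "k = k'") (auto simp: path_mult_line_path interval_act_line_path lookup_single when_def interval_act_0)
qed

lemma interval_mod_sum_singles:
  assumes "x \<in> mcarrier (interval_mod a b)"
  shows "(\<Sum>k\<in>{a..b}. Poly_Mapping.single k (Poly_Mapping.lookup x k)) = x"
proof (rule poly_mapping_eqI)
  fix i
  show "Poly_Mapping.lookup (\<Sum>k\<in>{a..b}. Poly_Mapping.single k (Poly_Mapping.lookup x k)) i =
      Poly_Mapping.lookup x i"
    using assms by (auto simp: lookup_sum lookup_single when_def sum.delta mem_interval_mod)
qed

lemma interval_mod_span: "pmv.span ((\<lambda>k. Poly_Mapping.single k (1::'k::field)) ` {a..b}) = mcarrier (interval_mod a b)"
proof (intro equalityI subsetI)
  fix x :: "nat \<Rightarrow>\<^sub>0 'k" assume "x \<in> pmv.span ((\<lambda>k. Poly_Mapping.single k 1) ` {a..b})"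
  moreover have "(\<lambda>k. Poly_Mapping.single k (1::'k)) ` {a..b} \<subseteq> mcarrier (interval_mod a b)"
    by (auto simp: mem_interval_mod lookup_single when_def)
  ultimately show "x \<in> mcarrier (interval_mod a b)"
    using pmv.span_minimal[OF _ interval_mod_subspace] by blast
next
  fix x :: "nat \<Rightarrow>\<^sub>0 'k" assume x: "x \<in> mcarrier (interval_mod a b)"
  have eq: "Poly_Mapping.single k (Poly_Mapping.lookup x k) =
      scl (Poly_Mapping.lookup x k) (Poly_Mapping.single k 1)" for k
    by (rule poly_mapping_eqI) (simp add: lookup_single when_def)
  have "(\<Sum>k\<in>{a..b}. Poly_Mapping.single k (Poly_Mapping.lookup x k))
      \<in> pmv.span ((\<lambda>k. Poly_Mapping.single k 1) ` {a..b})"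
    unfolding eq by (intro pmv.span_sum pmv.span_scale pmv.span_base imageI)
  then show "x \<in> pmv.span ((\<lambda>k. Poly_Mapping.single k 1) ` {a..b})"
    by (simp add: interval_mod_sum_singles[OF x])
qed

lemma interval_mod_module:
  assumes "1 \<le> a" "b \<le> n"
  shows "is_pa_module (equioriented_A n) (interval_mod a b :: (nat \<times> nat, 'k::field) pa_module)"
  unfolding is_pa_module_def
proof (intro conjI ballI allI)
  show "pmv.subspace (mcarrier (interval_mod a b))" by (rule interval_mod_subspace)
  show "\<exists>B. finite B \<and> pmv.span B = mcarrier (interval_mod a b)"
    using interval_mod_span by blast
next
  fix c :: "(nat \<times> nat) qpath \<Rightarrow>\<^sub>0 'k" and x :: "nat \<Rightarrow>\<^sub>0 'k"
  show "mact (interval_mod a b) c x \<in> mcarrier (interval_mod a b)"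
    by (subst interval_mod_def) (auto simp: linext_def interval_act_mem
      intro!: pmv.subspace_sum[OF interval_mod_subspace] pmv.subspace_scale[OF interval_mod_subspace])
next
  fix c :: "(nat \<times> nat) qpath \<Rightarrow>\<^sub>0 'k" and x y :: "nat \<Rightarrow>\<^sub>0 'k"
  show "mact (interval_mod a b) c (x + y) = mact (interval_mod a b) c x + mact (interval_mod a b) c y"
    by (simp add: interval_mod_def linext_def interval_act_add pmv.scale_right_distrib sum.distrib)
next
  fix c d :: "(nat \<times> nat) qpath \<Rightarrow>\<^sub>0 'k" and x :: "nat \<Rightarrow>\<^sub>0 'k"
  show "mact (interval_mod a b) (c + d) x = mact (interval_mod a b) c x + mact (interval_mod a b) d x"
    by (simp add: interval_mod_def linext_add)
next
  fix c :: "(nat \<times> nat) qpath \<Rightarrow>\<^sub>0 'k" and x :: "nat \<Rightarrow>\<^sub>0 'k" and r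
  show "mact (interval_mod a b) (scl r c) x = scl r (mact (interval_mod a b) c x)"
    by (simp add: interval_mod_def linext_scl)
  show "mact (interval_mod a b) c (scl r x) = scl r (mact (interval_mod a b) c x)"
    by (simp add: interval_mod_def linext_def interval_act_scl pmv.scale_sum_right mult.commute)
next
  fix c d :: "(nat \<times> nat) qpath \<Rightarrow>\<^sub>0 'k" and x :: "nat \<Rightarrow>\<^sub>0 'k"
  assume cd: "c \<in> pa_carrier (equioriented_A n)" "d \<in> pa_carrier (equioriented_A n)"
  have "linext (interval_act a b x) (pa_mult c d) = (\<Sum>p\<in>Poly_Mapping.keys c. \<Sum>q\<in>Poly_Mapping.keys d.
     scl (Poly_Mapping.lookup c p * Poly_Mapping.lookup d q) (interval_act a b (interval_act a b x q) p))"
    unfolding linext_pa_mult using cd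
    by (intro sum.cong refl arg_cong[of _ _ "scl _"] interval_act_path_mult[of _ n]) (auto simp: pa_carrier_def)
  also have "\<dots> = linext (interval_act a b (linext (interval_act a b x) d)) c"
    by (simp add: linext_def interval_act_sum interval_act_scl pmv.scale_sum_right)
  finally show "mact (interval_mod a b) (pa_mult c d) x = mact (interval_mod a b) c (mact (interval_mod a b) d x)"
    by (simp add: interval_mod_def)
next
  fix x :: "nat \<Rightarrow>\<^sub>0 'k" assume x: "x \<in> mcarrier (interval_mod a b)"
  have "mact (interval_mod a b) (pa_one (equioriented_A n)) x = (\<Sum>i\<in>{1..n}. path_act (interval_mod a b) i i x)"
    by (simp add: interval_mod_def pa_one_def linext_sum pa_idem_eq_path_elt)
  also have "\<dots> = (\<Sum>i\<in>{a..b}. Poly_Mapping.single i (Poly_Mapping.lookup x i))"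
    using assms by (intro sum.mono_neutral_cong_right) (auto simp: path_act_interval_mod)
  finally show "mact (interval_mod a b) (pa_one (equioriented_A n)) x = x"
    using interval_mod_sum_singles[OF x] by simp
qed

lemma dim_line:
  assumes "(x :: nat \<Rightarrow>\<^sub>0 'k::field) \<noteq> 0"
  shows "pmv.dim (range (\<lambda>r. scl r x)) = 1"
proof -
  have "pmv.independent {x}" using assms by (simp add: pmv.dependent_single)
  then have "pmv.dim (pmv.span {x}) = card {x}" by (rule pmv.dim_span_eq_card_independent)
  then show ?thesis by (simp add: pmv.span_singleton)
qed

lemma dim_trivial: "pmv.dim {0 :: nat \<Rightarrow>\<^sub>0 'k::field} = 0"
  using pmv.dim_span_eq_card_independent[OF pmv.independent_empty] by (simp add: pmv.span_empty)

lemma dim_vector_interval_mod: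
  assumes "1 \<le> a" "a \<le> b" "b \<le> n"
  shows "dim_vector (equioriented_A n) (interval_mod a b :: (nat \<times> nat, 'k::field) pa_module) = A_root a (Suc b)"
proof
  fix i
  have "mact (interval_mod a b) (pa_idem i) ` mcarrier (interval_mod a b) =
      (if i \<in> {a..b} then range (\<lambda>r. scl r (Poly_Mapping.single i (1::'k))) else {0})"
  proof (cases "i \<in> {a..b}")
    case True
    have eq: "scl r (Poly_Mapping.single i 1) = Poly_Mapping.single i r" for r :: 'k
      by (rule poly_mapping_eqI) (simp add: lookup_single when_def)
    have mem: "Poly_Mapping.single i r \<in> mcarrier (interval_mod a b)" for r :: 'k
      using True by (auto simp: mem_interval_mod lookup_single when_def)
    have act: "mact (interval_mod a b) (pa_idem i) x = Poly_Mapping.single i (Poly_Mapping.lookup x i)"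
      for x :: "nat \<Rightarrow>\<^sub>0 'k"
      using True by (simp add: pa_idem_eq_path_elt path_act_interval_mod)
    have "Poly_Mapping.single i r \<in> mact (interval_mod a b) (pa_idem i) ` mcarrier (interval_mod a b)" for r :: 'k
      by (rule image_eqI[OF _ mem[of r]]) (simp add: act)
    then show ?thesis using True by (auto simp: eq act)
  next
    case False
    have "0 \<in> mcarrier (interval_mod a b :: (nat \<times> nat, 'k) pa_module)" by (simp add: mem_interval_mod)
    then show ?thesis using False by (auto simp: pa_idem_eq_path_elt path_act_interval_mod)
  qed
  moreover have "Poly_Mapping.single i (1::'k) \<noteq> 0" by (metis lookup_single_eq lookup_zero one_neq_zero)
  ultimately show "dim_vector (equioriented_A n) (interval_mod a b :: (nat \<times> nat, 'k) pa_module) i = A_root a (Suc b) i"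
    using assms by (auto simp: dim_vector_def A_root_def dim_line dim_trivial)
qed

text \<open>
  The arrows lead from any nonzero component of a vector to the line at the last vertex, so that
  two nonzero submodules always meet.
\<close>

lemma interval_mod_indecomposable:
  assumes ab: "1 \<le> a" "a \<le> b" "b \<le> n"
  shows "indecomposable (equioriented_A n) (interval_mod a b :: (nat \<times> nat, 'k::field) pa_module)"
proof -
  let ?I = "interval_mod a b :: (nat \<times> nat, 'k) pa_module"
  let ?e = "Poly_Mapping.single b (1::'k)"
  have e: "?e \<in> mcarrier ?I" using ab by (auto simp: mem_interval_mod lookup_single when_def)
  have e0: "?e \<noteq> 0" by (metis lookup_single_eq lookup_zero one_neq_zero)
  have socle: "?e \<in> S" if S: "is_submodule (equioriented_A n) ?I S" "S \<noteq> {0}" for S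
  proof -
    have sub: "pmv.subspace S" "S \<subseteq> mcarrier ?I" using S by (auto simp: is_submodule_def)
    obtain x where x: "x \<in> S" "x \<noteq> 0" using S(2) pmv.subspace_0[OF sub(1)] by blast
    obtain k where k: "Poly_Mapping.lookup x k \<noteq> 0"
      using x(2) by (metis lookup_zero poly_mapping_eqI)
    have "x \<in> mcarrier ?I" using x(1) sub(2) by blast
    then have kab: "k \<in> {a..b}" using k unfolding mem_interval_mod by blast
    have "path_act ?I k b x \<in> S"
      using S(1) x(1) path_elt_carrier[of k b n] kab ab by (auto simp: is_submodule_def)
    then have "scl (inverse (Poly_Mapping.lookup x k)) (Poly_Mapping.single b (Poly_Mapping.lookup x k)) \<in> S"
      using kab ab by (intro pmv.subspace_scale[OF sub(1)]) (simp add: path_act_interval_mod)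
    moreover have "scl (inverse (Poly_Mapping.lookup x k)) (Poly_Mapping.single b (Poly_Mapping.lookup x k)) = ?e"
      using k by (intro poly_mapping_eqI) (simp add: lookup_single when_def)
    ultimately show ?thesis by simp
  qed
  then show ?thesis using e e0 unfolding indecomposable_def by blast
qed

text \<open>
  An interval module is generated by its first basis vector, subject to the relations that the
  paths to the vertices beyond \<open>b\<close> kill it.  A lift of this vector to the extension satisfies the
  relations as well: the result lies in the kernel of \<open>g\<close>, a copy of the interval module, which
  vanishes at these vertices.
\<close>

lemma interval_mod_Ext1_zero:
  assumes ab: "1 \<le> a" "a \<le> b" "b \<le> n"
  shows "Ext1_zero (equioriented_A n) (interval_mod a b) (interval_mod a b :: (nat \<times> nat, 'k::field) pa_module)"
  unfolding Ext1_zero_def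
proof (intro allI impI, elim conjE)
  let ?I = "interval_mod a b :: (nat \<times> nat, 'k) pa_module"
  fix E :: "(nat \<times> nat, 'k) pa_module" and f g
  assume E: "is_pa_module (equioriented_A n) E" and ex: "short_exact (equioriented_A n) ?I E ?I f g"
  have I: "is_pa_module (equioriented_A n) ?I" using interval_mod_module ab by blast
  have f: "pa_module_hom (equioriented_A n) ?I E f" and g: "pa_module_hom (equioriented_A n) E ?I g"
    and ker: "f ` mcarrier ?I = {x \<in> mcarrier E. g x = 0}" and surj: "g ` mcarrier E = mcarrier ?I"
    using ex by (auto simp: short_exact_def)
  have f_act: "f (path_act ?I u v x) = path_act E u v (f x)" if "1 \<le> u" "u \<le> v" "v \<le> n" "x \<in> mcarrier ?I" for u v x
    using f that path_elt_carrier[of u v n] by (auto simp: pa_module_hom_def)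
  have g_act: "g (path_act E u v x) = path_act ?I u v (g x)" if "1 \<le> u" "u \<le> v" "v \<le> n" "x \<in> mcarrier E" for u v x
    using g that path_elt_carrier[of u v n] by (auto simp: pa_module_hom_def)
  have "Poly_Mapping.single a 1 \<in> mcarrier ?I" using ab by (auto simp: mem_interval_mod lookup_single when_def)
  then obtain y0 where y0: "y0 \<in> mcarrier E" "g y0 = Poly_Mapping.single a 1"
    using surj by (metis imageE)
  define y where "y = path_act E a a y0"
  have y: "y \<in> mcarrier E" using path_act_closed[OF E] ab y0 by (auto simp: y_def)
  have gy: "g y = Poly_Mapping.single a 1"
    using ab y0 by (simp add: y_def g_act path_act_interval_mod)
  have y_act: "path_act E u v (path_act E a k y) = (if u = k then path_act E a v y else 0)"
    if "1 \<le> u" "u \<le> v" "v \<le> n" "a \<le> k" "k \<le> n" for u v k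
    using path_act_path_act[OF E, of a k u v y] that ab y by auto
  have y_dead: "path_act E a k y = 0" if k: "b < k" "k \<le> n" for k
  proof -
    have z: "path_act E a k y \<in> mcarrier E" using path_act_closed[OF E] ab y k by auto
    have "g (path_act E a k y) = 0" using ab y k by (simp add: g_act path_act_interval_mod)
    then obtain l where l: "l \<in> mcarrier ?I" "path_act E a k y = f l" using ker z by blast
    have "path_act E a k y = path_act E k k (path_act E a k y)" using y_act[of k k k] ab k by simp
    also have "\<dots> = f (path_act ?I k k l)" using f_act[of k k l] l ab k by simp
    also have "\<dots> = 0" using k hom_0[OF I f] by (simp add: path_act_interval_mod)
    finally show ?thesis .
  qed
  define s where "s x = (\<Sum>k\<in>{a..b}. scl (Poly_Mapping.lookup x k) (path_act E a k y))" for x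
  have sy: "scl r (path_act E a k y) \<in> mcarrier E" if "k \<in> {a..b}" for k r
    using that path_act_closed[OF E] ab y by (intro pmv.subspace_scale[OF carrier_subspace[OF E]]) auto
  have "pa_module_hom (equioriented_A n) ?I E s"
  proof (rule homI[OF I E])
    fix x assume "x \<in> mcarrier ?I"
    show "s x \<in> mcarrier E" unfolding s_def
      by (rule pmv.subspace_sum[OF carrier_subspace[OF E]]) (use sy in blast)
  next
    fix x y assume "x \<in> mcarrier ?I" "y \<in> mcarrier ?I"
    show "s (x + y) = s x + s y"
      by (simp add: s_def lookup_add pmv.scale_left_distrib sum.distrib)
  next
    fix r x assume "x \<in> mcarrier ?I"
    show "s (scl r x) = scl r (s x)" by (simp add: s_def pmv.scale_sum_right)
  next
    fix u v x assume uv: "1 \<le> u" "u \<le> v" "v \<le> n" and x: "x \<in> mcarrier ?I"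
    have "path_act E u v (s x) = (\<Sum>k\<in>{a..b}. path_act E u v (scl (Poly_Mapping.lookup x k) (path_act E a k y)))"
      unfolding s_def by (rule act_sum_right[OF E]) (use sy path_elt_carrier uv in auto)
    also have "\<dots> = (\<Sum>k\<in>{a..b}. if k = u then scl (Poly_Mapping.lookup x u) (path_act E a v y) else 0)"
    proof (rule sum.cong)
      fix k assume k: "k \<in> {a..b}"
      have "path_act E u v (scl (Poly_Mapping.lookup x k) (path_act E a k y)) =
          scl (Poly_Mapping.lookup x k) (path_act E u v (path_act E a k y))"
        by (rule act_scl_right[OF E]) (use path_elt_carrier uv k path_act_closed[OF E] ab y in auto)
      then show "path_act E u v (scl (Poly_Mapping.lookup x k) (path_act E a k y)) =
          (if k = u then scl (Poly_Mapping.lookup x u) (path_act E a v y) else 0)"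
        using y_act[of u v k] uv k ab by auto
    qed simp
    also have "\<dots> = (if u \<in> {a..b} then scl (Poly_Mapping.lookup x u) (path_act E a v y) else 0)"
      by (simp add: sum.delta)
    finally have lhs: "path_act E u v (s x) = (if u \<in> {a..b} then scl (Poly_Mapping.lookup x u) (path_act E a v y) else 0)" .
    have "s (Poly_Mapping.single v r) = (if v \<in> {a..b} then scl r (path_act E a v y) else 0)" for r
    proof -
      have "s (Poly_Mapping.single v r) = (\<Sum>k\<in>{a..b}. if k = v then scl r (path_act E a v y) else 0)"
        unfolding s_def by (intro sum.cong) (auto simp: lookup_single when_def)
      then show ?thesis by (simp add: sum.delta)
    qed
    moreover have "s 0 = 0" by (simp add: s_def)
    ultimately show "s (path_act ?I u v x) = path_act E u v (s x)"
      using uv y_dead[of v] by (auto simp: lhs path_act_interval_mod)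
  qed
  moreover have "g (s x) = x" if x: "x \<in> mcarrier ?I" for x
  proof -
    have "g (s x) = (\<Sum>k\<in>{a..b}. g (scl (Poly_Mapping.lookup x k) (path_act E a k y)))"
      unfolding s_def by (rule hom_sum[OF E g]) (use sy in blast)
    also have "\<dots> = (\<Sum>k\<in>{a..b}. Poly_Mapping.single k (Poly_Mapping.lookup x k))"
    proof (rule sum.cong)
      fix k assume k: "k \<in> {a..b}"
      have "g (scl (Poly_Mapping.lookup x k) (path_act E a k y)) = scl (Poly_Mapping.lookup x k) (g (path_act E a k y))"
        by (rule hom_scl[OF E I g]) (use k path_act_closed[OF E] ab y in auto)
      also have "\<dots> = scl (Poly_Mapping.lookup x k) (Poly_Mapping.single k 1)"
        using k ab y by (simp add: g_act gy path_act_interval_mod)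
      also have "\<dots> = Poly_Mapping.single k (Poly_Mapping.lookup x k)"
        by (rule poly_mapping_eqI) (simp add: lookup_single when_def)
      finally show "g (scl (Poly_Mapping.lookup x k) (path_act E a k y)) = Poly_Mapping.single k (Poly_Mapping.lookup x k)" .
    qed simp
    finally show ?thesis using interval_mod_sum_singles[OF x] by simp
  qed
  ultimately show "\<exists>s. pa_module_hom (equioriented_A n) ?I E s \<and> (\<forall>x\<in>mcarrier ?I. g (s x) = x)"
    by blast
qed

section \<open>Dimension vectors of indecomposable modules\<close>

text \<open>
  Let \<open>a\<close> be the first vertex at which the module is nonzero, \<open>X\<^sub>a \<noteq> 0\<close> a vector there, \<open>X\<^sub>k\<close> its
  image at \<open>k\<close>, and \<open>b\<close> the last vertex with \<open>X\<^sub>b \<noteq> 0\<close>.  The \<open>X\<^sub>k\<close> with \<open>a \<le> k \<le> b\<close> span an interval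
  module.  A linear form that does not vanish on \<open>X\<^sub>b\<close>, pulled back along the paths that end at
  \<open>b\<close>, cuts out a complement; it is a submodule because there is nothing before \<open>a\<close>.
\<close>

lemma indecomposable_dim_vector:
  fixes M :: "(nat \<times> nat, 'k::field) pa_module"
  assumes M: "is_pa_module (equioriented_A n) M" and indec: "indecomposable (equioriented_A n) M"
  obtains a b where "1 \<le> a" "a \<le> b" "b \<le> n" "dim_vector (equioriented_A n) M = A_root a (Suc b)"
proof -
  note sub = carrier_subspace[OF M] and closed = path_act_closed[OF M]
  have act_add: "path_act M u v (y + z) = path_act M u v y + path_act M u v z"
    if "1 \<le> u" "u \<le> v" "v \<le> n" "y \<in> mcarrier M" "z \<in> mcarrier M" for u v y z
    using act_add_right[OF M path_elt_carrier] that by blast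
  have act_scl: "path_act M u v (scl r z) = scl r (path_act M u v z)"
    if "1 \<le> u" "u \<le> v" "v \<le> n" "z \<in> mcarrier M" for u v z r
    using act_scl_right[OF M path_elt_carrier] that by blast
  have act0: "path_act M u v 0 = 0" if "1 \<le> u" "u \<le> v" "v \<le> n" for u v
    using act_0_right[OF M path_elt_carrier] that by blast
  have comp: "path_act M k v (path_act M u j x) = (if k = j then path_act M u v x else 0)"
    if "1 \<le> u" "u \<le> j" "j \<le> n" "1 \<le> k" "k \<le> v" "v \<le> n" "x \<in> mcarrier M" for u j k v x
    using path_act_path_act[OF M] that by blast
  define P where "P i \<longleftrightarrow> 1 \<le> i \<and> i \<le> n \<and> (\<exists>x\<in>mcarrier M. path_act M i i x \<noteq> 0)" for i
  have "mcarrier M \<noteq> {0}" using indec by (simp add: indecomposable_def)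
  then obtain x1 where x1: "x1 \<in> mcarrier M" "x1 \<noteq> 0" using pmv.subspace_0[OF sub] by blast
  have "\<exists>i\<in>{1..n}. path_act M i i x1 \<noteq> 0"
  proof (rule ccontr)
    assume "\<not> ?thesis"
    then have "(\<Sum>i\<in>{1..n}. path_act M i i x1) = 0" by (intro sum.neutral) blast
    then show False using sum_pact_idem[OF M x1(1)] x1(2) by simp
  qed
  then obtain i1 where "i1 \<in> {1..n}" "path_act M i1 i1 x1 \<noteq> 0" by blast
  then have "P i1" using x1 by (auto simp: P_def)
  define a where "a = (LEAST i. P i)"
  have "P a" unfolding a_def by (rule LeastI[of P, OF \<open>P i1\<close>])
  have a_min: "path_act M i i x = 0" if "1 \<le> i" "i < a" "i \<le> n" "x \<in> mcarrier M" for i x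
    using not_less_Least[of i P] that by (auto simp: a_def P_def)
  obtain x0 where a: "1 \<le> a" "a \<le> n" and x0: "x0 \<in> mcarrier M" "path_act M a a x0 \<noteq> 0"
    using \<open>P a\<close> by (auto simp: P_def)
  define X where "X k = path_act M a k x0" for k
  have X_mem: "X k \<in> mcarrier M" if "a \<le> k" "k \<le> n" for k
    using that closed a x0 by (simp add: X_def)
  have X_act: "path_act M u v (X k) = (if u = k then X v else 0)"
    if "1 \<le> u" "u \<le> v" "v \<le> n" "a \<le> k" "k \<le> n" for u v k
    using comp[of a k u v x0] that a x0 by (auto simp: X_def)
  define J where "J = {k. a \<le> k \<and> k \<le> n \<and> X k \<noteq> 0}"
  have J: "finite J" "a \<in> J" using a x0 by (auto simp: J_def X_def)
  define b where "b = Max J"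
  have "b \<in> J" using J Max_in unfolding b_def by blast
  then have b: "a \<le> b" "b \<le> n" "X b \<noteq> 0" by (auto simp: J_def)
  have X_dead: "X k = 0" if "b < k" "k \<le> n" for k
  proof (rule ccontr)
    assume "X k \<noteq> 0"
    then have "k \<in> J" using that b by (auto simp: J_def)
    then show False using Max_ge[OF J(1)] that by (force simp: b_def)
  qed
  have X_alive: "X k \<noteq> 0" if "k \<in> {a..b}" for k
    using X_act[of k b k] act0[of k b] that a b by auto
  obtain t where t: "Poly_Mapping.lookup (X b) t \<noteq> 0"
    using b(3) by (metis lookup_zero poly_mapping_eqI)
  \<comment> \<open>The linear form is the coordinate \<open>t\<close>, normalised to take the value 1 on \<open>X b\<close>.\<close>
  define \<phi> where "\<phi> k z = Poly_Mapping.lookup (path_act M k b z) t / Poly_Mapping.lookup (X b) t" for k z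
  have \<phi>_add: "\<phi> k (y + z) = \<phi> k y + \<phi> k z"
    if "k \<in> {a..b}" "y \<in> mcarrier M" "z \<in> mcarrier M" for k y z
    using that act_add[of k b y z] a b by (simp add: \<phi>_def lookup_add add_divide_distrib)
  have \<phi>_scl: "\<phi> k (scl r z) = r * \<phi> k z" if "k \<in> {a..b}" "z \<in> mcarrier M" for k r z
    using that act_scl[of k b z r] a b by (simp add: \<phi>_def)
  have \<phi>_0: "\<phi> k 0 = 0" if "k \<in> {a..b}" for k
    using that act0[of k b] a b by (simp add: \<phi>_def)
  have \<phi>_X: "\<phi> k (X j) = (if k = j then 1 else 0)" if "k \<in> {a..b}" "j \<in> {a..b}" for k j
    using that X_act[of k b j] a b t by (auto simp: \<phi>_def)
  \<comment> \<open>The projection to the span of the \<open>X k\<close>, the complement being its kernel.\<close>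
  define pr where "pr z = (\<Sum>k\<in>{a..b}. scl (\<phi> k z) (X k))" for z
  have scX: "scl r (X k) \<in> mcarrier M" if "k \<in> {a..b}" for r k
    using that X_mem b by (intro pmv.subspace_scale[OF sub]) auto
  have pr_mem: "pr z \<in> mcarrier M" for z
    unfolding pr_def by (rule pmv.subspace_sum[OF sub]) (use scX in blast)
  have pr_add: "pr (y + z) = pr y + pr z" if "y \<in> mcarrier M" "z \<in> mcarrier M" for y z
    using that by (simp add: pr_def \<phi>_add pmv.scale_left_distrib sum.distrib)
  have pr_scl: "pr (scl r z) = scl r (pr z)" if "z \<in> mcarrier M" for r z
    using that by (simp add: pr_def \<phi>_scl pmv.scale_sum_right)
  have pr_X: "pr (scl r (X j)) = scl r (X j)" if "j \<in> {a..b}" for j r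
  proof -
    have "pr (scl r (X j)) = (\<Sum>k\<in>{a..b}. if k = j then scl r (X j) else 0)"
      unfolding pr_def using that X_mem b by (intro sum.cong) (auto simp: \<phi>_scl \<phi>_X)
    then show ?thesis using that by (simp add: sum.delta)
  qed
  have \<phi>_sum: "\<phi> j (\<Sum>k\<in>A. y k) = (\<Sum>k\<in>A. \<phi> j (y k))"
    if "j \<in> {a..b}" "\<And>k. k \<in> A \<Longrightarrow> y k \<in> mcarrier M" for j and A :: "nat set" and y
    using that
    by (induction A rule: infinite_finite_induct) (auto simp: \<phi>_0 \<phi>_add pmv.subspace_sum[OF sub])
  have \<phi>_pr: "\<phi> j (pr z) = \<phi> j z" if "j \<in> {a..b}" for j z
  proof -
    have "\<phi> j (pr z) = (\<Sum>k\<in>{a..b}. \<phi> j (scl (\<phi> k z) (X k)))"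
      unfolding pr_def by (rule \<phi>_sum) (use that scX in auto)
    also have "\<dots> = (\<Sum>k\<in>{a..b}. if k = j then \<phi> j z else 0)"
      using that X_mem b by (intro sum.cong) (auto simp: \<phi>_scl \<phi>_X)
    finally show ?thesis using that by (simp add: sum.delta)
  qed
  have act_pr: "path_act M u v (pr z) = (if u \<in> {a..b} then scl (\<phi> u z) (X v) else 0)"
    if uv: "1 \<le> u" "u \<le> v" "v \<le> n" for u v z
  proof -
    have "path_act M u v (pr z) = (\<Sum>k\<in>{a..b}. path_act M u v (scl (\<phi> k z) (X k)))"
      unfolding pr_def by (rule act_sum_right[OF M]) (use scX path_elt_carrier uv in auto)
    also have "\<dots> = (\<Sum>k\<in>{a..b}. if k = u then scl (\<phi> u z) (X v) else 0)"
      using uv b X_mem by (intro sum.cong) (auto simp: act_scl X_act)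
    finally show ?thesis by (simp add: sum.delta)
  qed
  define S where "S = {z \<in> mcarrier M. pr z = z}"
  define T where "T = {z \<in> mcarrier M. \<forall>k\<in>{a..b}. \<phi> k z = 0}"
  have pr0: "pr 0 = 0" by (simp add: pr_def \<phi>_0)
  have "is_submodule (equioriented_A n) M S"
  proof (rule submoduleI[OF M])
    show "pmv.subspace S"
      using pmv.subspace_0[OF sub] pmv.subspace_add[OF sub] pmv.subspace_scale[OF sub]
      by (intro pmv.subspaceI) (auto simp: S_def pr0 pr_add pr_scl)
    fix u v z assume uv: "1 \<le> u" "u \<le> v" "v \<le> n" and z: "z \<in> S"
    have "pr (path_act M u v z) = path_act M u v z"
    proof (cases "u \<in> {a..b} \<and> v \<le> b")
      case True
      then have "path_act M u v z = scl (\<phi> u z) (X v)" using act_pr[OF uv, of z] z by (simp add: S_def)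
      then show ?thesis using True uv pr_X[of v] by simp
    next
      case False
      then have "path_act M u v z = 0" using act_pr[OF uv, of z] z X_dead[of v] uv by (auto simp: S_def)
      then show ?thesis using pr0 by simp
    qed
    then show "path_act M u v z \<in> S" using closed uv z by (simp add: S_def)
  qed (auto simp: S_def)
  moreover have "is_submodule (equioriented_A n) M T"
  proof (rule submoduleI[OF M])
    show "pmv.subspace T"
      using pmv.subspace_0[OF sub] pmv.subspace_add[OF sub] pmv.subspace_scale[OF sub]
      by (intro pmv.subspaceI) (auto simp: T_def \<phi>_0 \<phi>_add \<phi>_scl)
    fix u v z assume uv: "1 \<le> u" "u \<le> v" "v \<le> n" and z: "z \<in> T"
    have "\<phi> k (path_act M u v z) = 0" if k: "k \<in> {a..b}" for k
    proof (cases "k = v")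
      case True
      have ub: "path_act M k b (path_act M u v z) = path_act M u b z"
        using comp[of u v k b z] uv k a b z True by (auto simp: T_def)
      show ?thesis
      proof (cases "u < a")
        case True
        have "path_act M u b z = path_act M u b (path_act M u u z)"
          using comp[of u u u b z] uv k b z \<open>k = v\<close> by (auto simp: T_def)
        also have "\<dots> = 0"
          using a_min[of u z] True uv z act0[of u b] b k \<open>k = v\<close> by (auto simp: T_def)
        finally show ?thesis by (simp add: \<phi>_def ub)
      next
        case False
        then have "\<phi> u z = 0" using z uv k True by (auto simp: T_def)
        then show ?thesis by (simp add: \<phi>_def ub)
      qed
    next
      case False
      then have "path_act M k b (path_act M u v z) = 0"
        using comp[of u v k b z] uv k a b z by (auto simp: T_def)
      then show ?thesis by (simp add: \<phi>_def)
    qed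
    then show "path_act M u v z \<in> T" using closed uv z by (simp add: T_def)
  qed (auto simp: T_def)
  moreover have "S \<inter> T = {0}"
  proof -
    have "z = 0" if "z \<in> S" "z \<in> T" for z
    proof -
      have "z = pr z" using that by (simp add: S_def)
      also have "\<dots> = 0" unfolding pr_def using that by (intro sum.neutral) (simp add: T_def)
      finally show ?thesis .
    qed
    then show ?thesis using pmv.subspace_0[OF sub] by (auto simp: S_def T_def pr0 \<phi>_0)
  qed
  moreover have "{s + t | s t. s \<in> S \<and> t \<in> T} = mcarrier M"
  proof (intro equalityI subsetI)
    fix z assume "z \<in> {s + t | s t. s \<in> S \<and> t \<in> T}"
    then show "z \<in> mcarrier M" using pmv.subspace_add[OF sub] by (auto simp: S_def T_def)
  next
    fix z assume z: "z \<in> mcarrier M"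
    have prS: "pr z \<in> S"
      using pr_mem \<phi>_pr by (simp add: S_def pr_def[of "pr z"]) (simp add: pr_def)
    have m: "z - pr z \<in> mcarrier M" using pmv.subspace_diff[OF sub z pr_mem] .
    have "\<phi> k (z - pr z) = 0" if k: "k \<in> {a..b}" for k
      using \<phi>_add[OF k m pr_mem[of z]] \<phi>_pr[OF k, of z] by simp
    then have "z - pr z \<in> T" using m by (simp add: T_def)
    moreover have "z = pr z + (z - pr z)" by simp
    ultimately show "z \<in> {s + t | s t. s \<in> S \<and> t \<in> T}" using prS by blast
  qed
  moreover have "S \<noteq> {0}"
  proof -
    have "X a \<in> S" using pr_X[of a 1] X_mem b a by (simp add: S_def)
    then show ?thesis using X_alive[of a] b by auto
  qed
  ultimately have "T = {0}" using indec unfolding indecomposable_def by (elim conjE) (rule ccontr, blast)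
  then have all: "pr z = z" if "z \<in> mcarrier M" for z
    using that \<open>{s + t | s t. s \<in> S \<and> t \<in> T} = mcarrier M\<close> by (auto simp: S_def)
  have "dim_vector (equioriented_A n) M i = A_root a (Suc b) i" for i
  proof (cases "i \<in> {1..n}")
    case True
    have act: "path_act M i i z = (if i \<in> {a..b} then scl (\<phi> i z) (X i) else 0)"
      if "z \<in> mcarrier M" for z
      using act_pr[of i i z] True all[OF that] by simp
    show ?thesis
    proof (cases "i \<in> {a..b}")
      case iab: True
      have "scl r (X i) \<in> path_act M i i ` mcarrier M" for r
      proof (rule image_eqI)
        show "scl r (X i) \<in> mcarrier M" by (rule scX[OF iab])
        show "scl r (X i) = path_act M i i (scl r (X i))"
          using iab X_mem[of i] b by (simp add: act scX \<phi>_scl \<phi>_X)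
      qed
      then have "path_act M i i ` mcarrier M = range (\<lambda>r. scl r (X i))"
        using act iab by auto
      then show ?thesis using True iab X_alive[OF iab]
        by (simp add: dim_vector_def pa_idem_eq_path_elt dim_line A_root_def)
    next
      case False
      then have "path_act M i i ` mcarrier M = {0}"
        using act pmv.subspace_0[OF sub] by (auto simp: image_iff intro!: bexI[of _ 0])
      then show ?thesis using True False b
        by (auto simp: dim_vector_def pa_idem_eq_path_elt dim_trivial A_root_def)
    qed
  next
    case False
    then show ?thesis using a b by (auto simp: dim_vector_def A_root_def)
  qed
  then show ?thesis using that a b by blast
qed

lemma real_Schur_roots_A:
  "real_Schur_roots TYPE('k::alg_closed_field) (equioriented_A n) = {A_root a (Suc b) | a b. 1 \<le> a \<and> a \<le> b \<and> b \<le> n}"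
proof (intro equalityI subsetI)
  fix d assume "d \<in> real_Schur_roots TYPE('k) (equioriented_A n)"
  then obtain M :: "(nat \<times> nat, 'k) pa_module" where
    "is_pa_module (equioriented_A n) M" "indecomposable (equioriented_A n) M"
    "d = dim_vector (equioriented_A n) M"
    unfolding real_Schur_roots_def by blast
  then show "d \<in> {A_root a (Suc b) | a b. 1 \<le> a \<and> a \<le> b \<and> b \<le> n}"
    using indecomposable_dim_vector by blast
next
  fix d assume "d \<in> {A_root a (Suc b) | a b. 1 \<le> a \<and> a \<le> b \<and> b \<le> n}"
  then obtain a b where ab: "1 \<le> a" "a \<le> b" "b \<le> n" "d = A_root a (Suc b)" by blast
  let ?I = "interval_mod a b :: (nat \<times> nat, 'k) pa_module"
  have "d = dim_vector (equioriented_A n) ?I" using dim_vector_interval_mod ab by metis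
  then show "d \<in> real_Schur_roots TYPE('k) (equioriented_A n)"
    unfolding real_Schur_roots_def
    using interval_mod_module[of a b n] interval_mod_indecomposable[OF ab(1-3)] interval_mod_Ext1_zero[OF ab(1-3)] ab by blast
qed

section \<open>Polar coordinates on the polygon\<close>

text \<open>
  The angle between the normal of an edge and a vertex is an odd multiple of \<open>\<pi>/N\<close>; it is smallest
  in absolute value, modulo \<open>2\<pi>\<close>, for the two ends of the edge.
\<close>

lemma cos_le_cos_unit:
  assumes N: "N \<ge> 2" and d: "- int N \<le> d" "d < int N"
  shows "cos (pi * real_of_int (2 * d + 1) / N) \<le> cos (pi / N)"
    and "cos (pi * real_of_int (2 * d + 1) / N) = cos (pi / N) \<Longrightarrow> d \<in> {0, -1, int N - 1, - int N}"
proof -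
  define x where "x = pi * real_of_int \<bar>2 * d + 1\<bar> / N"
  have N0: "real N > 0" using N by simp
  have cosx: "cos (pi * real_of_int (2 * d + 1) / N) = cos x"
  proof (cases "2 * d + 1 \<ge> 0")
    case False
    then have "\<bar>2 * d + 1\<bar> = - (2 * d + 1)" by (simp only: abs_if) simp
    then have "x = - (pi * real_of_int (2 * d + 1) / N)"
      unfolding x_def by (simp only: of_int_minus mult_minus_right minus_divide_left)
    then show ?thesis by (simp only: cos_minus)
  qed (simp add: x_def)
  have bounds: "1 \<le> \<bar>2 * d + 1\<bar>" "\<bar>2 * d + 1\<bar> \<le> 2 * int N - 1" using d by arith+
  have lt: "cos x < cos (pi / N)" if "\<bar>2 * d + 1\<bar> \<noteq> 1" "\<bar>2 * d + 1\<bar> \<noteq> 2 * int N - 1"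
  proof -
    have "1 < real_of_int \<bar>2 * d + 1\<bar>" using that bounds by linarith
    then have 1: "pi / N < x" using N0 by (simp add: x_def divide_strict_right_mono)
    have "real_of_int \<bar>2 * d + 1\<bar> < 2 * real N - 1" using that bounds by linarith
    then have "pi * real_of_int \<bar>2 * d + 1\<bar> < pi * (2 * real N - 1)" by simp
    then have "x < pi * (2 * real N - 1) / N" using N0 by (simp only: x_def divide_strict_right_mono)
    also have "\<dots> = 2 * pi - pi / N" using N0 by (simp add: field_simps)
    finally have 2: "x < 2 * pi - pi / N" .
    have pN: "0 \<le> pi / N" using N0 by simp
    show ?thesis
    proof (cases "x \<le> pi")
      case True
      then show ?thesis using cos_monotone_0_pi[of "pi / N" x] 1 pN by simp
    next
      case False
      then have "cos (2 * pi - x) < cos (pi / N)" using cos_monotone_0_pi[of "pi / N" "2 * pi - x"] 2 pN by simp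
      then show ?thesis by simp
    qed
  qed
  have eq: "cos x = cos (pi / N)" if "\<bar>2 * d + 1\<bar> = 1 \<or> \<bar>2 * d + 1\<bar> = 2 * int N - 1"
  proof (cases "\<bar>2 * d + 1\<bar> = 1")
    case False
    then have *: "real_of_int \<bar>2 * d + 1\<bar> = 2 * real N - 1" using that by simp
    have "x = 2 * pi - pi / N" unfolding x_def * using N0 by (simp add: field_simps)
    then show ?thesis by simp
  qed (simp add: x_def)
  show "cos (pi * real_of_int (2 * d + 1) / N) \<le> cos (pi / N)"
    unfolding cosx using lt eq by linarith
  assume "cos (pi * real_of_int (2 * d + 1) / N) = cos (pi / N)"
  then have "\<bar>2 * d + 1\<bar> = 1 \<or> \<bar>2 * d + 1\<bar> = 2 * int N - 1" using lt cosx by fastforce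
  then show "d \<in> {0, -1, int N - 1, - int N}" by auto
qed

text \<open>
  The component of \<open>z\<close> in the direction of the midpoint of the \<open>j\<close>-th edge.  For \<open>N \<ge> 3\<close> the polygon
  is cut out by the inequalities \<open>edge_height N j z \<le> cos (\<pi>/N)\<close>, and the \<open>j\<close>-th edge by equality.
  The bigon has to be treated separately, as \<open>cos (\<pi>/2) = 0\<close> and its edges are not straight.
\<close>

definition edge_height :: "nat \<Rightarrow> nat \<Rightarrow> complex \<Rightarrow> real" where
  "edge_height N j z = Re (z * cis (- (pi * (2 * real j - 1) / N)))"

lemma edge_height_linear:
  "edge_height N j (of_real r * z) = r * edge_height N j z"
  "edge_height N j (z + w) = edge_height N j z + edge_height N j w"
  by (simp_all add: edge_height_def algebra_simps)

lemma edge_height_vertex: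
  assumes "N \<ge> 2" "j \<in> {1..N}" "k \<le> N"
  shows "edge_height N j (gon_vertex N k) \<le> cos (pi / N)"
    and "edge_height N j (gon_vertex N k) = cos (pi / N) \<Longrightarrow>
      k = j \<or> Suc k = j \<or> (k = N \<and> j = 1) \<or> (k = 0 \<and> j = N)"
proof -
  define d where "d = int k - int j"
  have d: "- int N \<le> d" "d < int N" using assms by (auto simp: d_def)
  have "2 * pi * real k / N + - (pi * (2 * real j - 1) / N) = (2 * pi * real k - pi * (2 * real j - 1)) / N"
    by (simp add: diff_divide_distrib)
  also have "2 * pi * real k - pi * (2 * real j - 1) = pi * real_of_int (2 * d + 1)"
    by (simp add: d_def algebra_simps)
  finally have eq: "2 * pi * real k / N + - (pi * (2 * real j - 1) / N) = pi * real_of_int (2 * d + 1) / N" .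
  have h: "edge_height N j (gon_vertex N k) = cos (pi * real_of_int (2 * d + 1) / N)"
    unfolding edge_height_def gon_vertex_def cis_mult eq by simp
  show "edge_height N j (gon_vertex N k) \<le> cos (pi / N)"
    unfolding h by (rule cos_le_cos_unit[OF assms(1) d])
  assume "edge_height N j (gon_vertex N k) = cos (pi / N)"
  then have "d \<in> {0, -1, int N - 1, - int N}"
    unfolding h by (rule cos_le_cos_unit[OF assms(1) d])
  then show "k = j \<or> Suc k = j \<or> (k = N \<and> j = 1) \<or> (k = 0 \<and> j = N)"
    using assms by (auto simp: d_def)
qed

lemma edge_height_own_vertices:
  assumes "j \<ge> 1"
  shows "edge_height N j (gon_vertex N (j - 1)) = cos (pi / N)" "edge_height N j (gon_vertex N j) = cos (pi / N)"
proof -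
  have eq1: "2 * pi * real (j - 1) / N + - (pi * (2 * real j - 1) / N) = - (pi / N)"
    using assms by (simp add: of_nat_diff field_simps diff_divide_distrib[symmetric] add_divide_distrib[symmetric])
  show "edge_height N j (gon_vertex N (j - 1)) = cos (pi / N)"
    unfolding edge_height_def gon_vertex_def cis_mult eq1 by simp
  have eq2: "2 * pi * real j / N + - (pi * (2 * real j - 1) / N) = pi / N"
    by (simp add: field_simps diff_divide_distrib[symmetric] add_divide_distrib[symmetric])
  show "edge_height N j (gon_vertex N j) = cos (pi / N)"
    unfolding edge_height_def gon_vertex_def cis_mult eq2 by simp
qed

lemma gon_edge_ends [simp]:
  assumes "m \<ge> 1"
  shows "gon_edge N m 0 = gon_vertex N (m - 1)" "gon_edge N m 1 = gon_vertex N m"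
  using assms by (auto simp: gon_edge_def gon_vertex_def of_nat_diff)

lemma edge_height_edge:
  assumes "N \<ge> 3" "j \<in> {1..N}" "m \<in> {1..N}" "t \<in> {0..1}"
  shows "edge_height N j (gon_edge N m t) \<le> cos (pi / N)"
    and "edge_height N m (gon_edge N m t) = cos (pi / N)"
    and "edge_height N j (gon_edge N m t) = cos (pi / N) \<Longrightarrow> 0 < t \<Longrightarrow> t < 1 \<Longrightarrow> j = m"
proof -
  define c where "c = cos (pi / N)"
  let ?a = "edge_height N j (gon_vertex N (m - 1))" and ?b = "edge_height N j (gon_vertex N m)"
  have h: "edge_height N j' (gon_edge N m t) =
      (1 - t) * edge_height N j' (gon_vertex N (m - 1)) + t * edge_height N j' (gon_vertex N m)" for j'
  proof -
    have "gon_edge N m t = of_real (1 - t) * gon_vertex N (m - 1) + of_real t * gon_vertex N m"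
      using assms(1) by (simp add: gon_edge_def)
    then show ?thesis by (simp only: edge_height_linear)
  qed
  have a: "?a \<le> c" and b: "?b \<le> c"
    unfolding c_def using assms by (intro edge_height_vertex; auto)+
  have a': "(1 - t) * ?a \<le> (1 - t) * c" and b': "t * ?b \<le> t * c"
    using a b assms(4) by (auto intro: mult_left_mono)
  then show "edge_height N j (gon_edge N m t) \<le> cos (pi / N)"
    unfolding h c_def[symmetric] by (simp add: algebra_simps)
  show "edge_height N m (gon_edge N m t) = cos (pi / N)"
  proof -
    have m: "m \<ge> 1" using assms by simp
    show ?thesis unfolding h edge_height_own_vertices[OF m] by (simp add: algebra_simps)
  qed
  assume eq: "edge_height N j (gon_edge N m t) = cos (pi / N)" and t: "0 < t" "t < 1"
  have "(1 - t) * ?a + t * ?b = (1 - t) * c + t * c"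
    using eq unfolding h c_def by (simp add: algebra_simps)
  then have "(1 - t) * ?a = (1 - t) * c" "t * ?b = t * c" using a' b' by linarith+
  then have "?a = c" "?b = c" using t by auto
  then have "m - 1 = j \<or> Suc (m - 1) = j \<or> (m - 1 = N \<and> j = 1) \<or> (m - 1 = 0 \<and> j = N)"
     "m = j \<or> Suc m = j \<or> (m = N \<and> j = 1) \<or> (m = 0 \<and> j = N)"
    unfolding c_def using assms by (intro edge_height_vertex; auto)+
  then show "j = m" using assms by auto
qed

lemma gon_vertex_inj:
  assumes "gon_vertex N k = gon_vertex N k'" "k < N" "k' < N"
  shows "k = k'"
proof (rule inj_onD)
  show "inj_on (\<lambda>k. cis (2 * pi * real k / real N)) {..<N}"
    using bij_betw_imp_inj_on[OF Complex.bij_betw_roots_unity[of N]] assms by simp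
qed (use assms in \<open>auto simp: gon_vertex_def\<close>)

text \<open>
  The boundary of the polygon as a closed curve on \<open>[0, N]\<close>, the \<open>m\<close>-th edge being traversed on
  \<open>[m - 1, m]\<close>.  Writing it as a telescoping sum makes continuity evident.
\<close>

definition boundary_pt :: "nat \<Rightarrow> real \<Rightarrow> complex" where
  "boundary_pt N \<theta> = gon_vertex N 0 +
     (\<Sum>m\<in>{1..N}. gon_edge N m (max 0 (min 1 (\<theta> - real (m - 1)))) - gon_vertex N (m - 1))"

lemma continuous_gon_edge: "continuous_on UNIV (gon_edge N m)"
proof (cases "N \<le> 2")
  case True
  then have eq: "gon_edge N m = (\<lambda>t. cis (2 * pi * (real m - 1 + t) / real N))"
    by (auto simp: gon_edge_def)
  show ?thesis unfolding eq cis_conv_exp divide_inverse by (intro continuous_intros)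
next
  case False
  then have "gon_edge N m = (\<lambda>t. of_real (1 - t) * gon_vertex N (m - 1) + of_real t * gon_vertex N m)"
    by (auto simp: gon_edge_def)
  then show ?thesis by (auto intro!: continuous_intros)
qed

lemma continuous_boundary_pt: "continuous_on UNIV (boundary_pt N)"
  unfolding boundary_pt_def
  by (intro continuous_intros continuous_on_compose2[OF continuous_gon_edge]) auto

lemma boundary_pt_edge:
  assumes m: "m \<in> {1..N}" and t: "t \<in> {0..1}"
  shows "boundary_pt N (real (m - 1) + t) = gon_edge N m t"
proof -
  let ?g = "\<lambda>j. gon_edge N j (max 0 (min 1 (real (m - 1) + t - real (j - 1)))) - gon_vertex N (j - 1)"
  have early: "?g j = gon_vertex N j - gon_vertex N (j - 1)" if "j \<in> {1..<m}" for j
  proof -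
    have "real (m - 1) - real (j - 1) \<ge> 1" using that by auto
    then have "max 0 (min 1 (real (m - 1) + t - real (j - 1))) = 1" using t by auto
    then show ?thesis using that by simp
  qed
  have late: "?g j = 0" if "j \<in> {m<..N}" for j
  proof -
    have "real (m - 1) - real (j - 1) \<le> -1" using that m by auto
    then have "max 0 (min 1 (real (m - 1) + t - real (j - 1))) = 0" using t by auto
    then show ?thesis using that by simp
  qed
  have split: "{1..N} = {1..<m} \<union> ({m} \<union> {m<..N})" using m by auto
  have "(\<Sum>j\<in>{1..N}. ?g j) = sum ?g {1..<m} + sum ?g ({m} \<union> {m<..N})"
    unfolding split by (rule sum.union_disjoint) auto
  also have "sum ?g ({m} \<union> {m<..N}) = sum ?g {m} + sum ?g {m<..N}"
    by (rule sum.union_disjoint) auto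
  also have "sum ?g {m} = ?g m" by simp
  also have "sum ?g {m<..N} = 0" using late by (intro sum.neutral) blast
  also have "sum ?g {1..<m} = (\<Sum>j\<in>{1..<m}. gon_vertex N j - gon_vertex N (j - 1))"
    using early by (intro sum.cong) auto
  also have "\<dots> = gon_vertex N (m - 1) - gon_vertex N 0"
    using m
  proof (induction m)
    case (Suc m)
    then show ?case by (cases m) auto
  qed simp
  also have "?g m = gon_edge N m t - gon_vertex N (m - 1)" using t by auto
  finally show ?thesis by (simp add: boundary_pt_def)
qed

lemma boundary_pt_cases:
  assumes "N \<ge> 1" "0 \<le> \<theta>" "\<theta> < real N"
  obtains m t where "m \<in> {1..N}" "0 \<le> t" "t < 1" "\<theta> = real (m - 1) + t" "boundary_pt N \<theta> = gon_edge N m t"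
proof -
  define m where "m = Suc (nat \<lfloor>\<theta>\<rfloor>)"
  define t where "t = \<theta> - real (m - 1)"
  have m: "m \<in> {1..N}" using assms by (auto simp: m_def) linarith
  have t: "0 \<le> t" "t < 1" using assms by (auto simp: t_def m_def) linarith
  have "\<theta> = real (m - 1) + t" by (simp add: t_def)
  then show ?thesis using that[of m t] m t boundary_pt_edge[of m N t] by simp
qed

lemma edge_eq_imp:
  assumes N: "N \<ge> 2" and m: "m \<in> {1..N}" "m' \<in> {1..N}" and t: "0 < t" "t < 1" "t' \<in> {0..1}"
    and eq: "gon_edge N m t = gon_edge N m' t'"
  shows "m = m' \<and> t = t'"
proof (cases "N = 2")
  case True
  define a where "a = real m - 1 + t"
  define a' where "a' = real m' - 1 + t'"
  have "cis (pi * a) = cis (pi * a')"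
    using eq True by (simp add: gon_edge_def a_def a'_def)
  then have "cos (pi * a) = cos (pi * a')" "sin (pi * a) = sin (pi * a')"
    by (simp_all add: complex_eq_iff)
  then have "cos (pi * a - pi * a') = 1"
    by (simp add: cos_diff)
  then obtain k :: int where "pi * a - pi * a' = of_int k * 2 * pi"
    using cos_one_2pi_int by blast
  then have "pi * (a - a') = pi * (2 * of_int k)" by (simp add: algebra_simps)
  then have k: "a - a' = 2 * of_int k" by simp
  have "0 < a" "a < 2" "0 \<le> a'" "a' \<le> 2" using m t True by (auto simp: a_def a'_def)
  then have "k < 1" "k > -1" using k by linarith+
  then have "a = a'" using k by simp
  moreover have "m = 1 \<or> m = 2" "m' = 1 \<or> m' = 2" using m True by auto
  ultimately show ?thesis using t by (auto simp: a_def a'_def)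
next
  case False
  then have N3: "N \<ge> 3" using N by simp
  have "edge_height N m' (gon_edge N m t) = cos (pi / N)"
    unfolding eq using edge_height_edge(2)[OF N3 m(2,2) t(3)] .
  then have mm: "m = m'" using edge_height_edge(3)[OF N3 m(2,1)] t by auto
  have "of_real (t - t') * (gon_vertex N m - gon_vertex N (m - 1)) = 0"
    using eq False N unfolding mm by (simp add: gon_edge_def algebra_simps)
  moreover have "gon_vertex N m \<noteq> gon_vertex N (m - 1)"
  proof
    assume *: "gon_vertex N m = gon_vertex N (m - 1)"
    show False
    proof (cases "m = N")
      case True
      then have "gon_vertex N 0 = gon_vertex N (N - 1)" using * N by (simp add: gon_vertex_def)
      then show False using gon_vertex_inj[of N 0 "N - 1"] N by simp
    next
      case False
      then show False using gon_vertex_inj[OF *] m by (cases m) auto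
    qed
  qed
  ultimately show ?thesis using mm by simp
qed

lemma boundary_pt_inj:
  assumes N: "N \<ge> 2" and \<theta>: "0 \<le> \<theta>" "\<theta> < real N" "0 \<le> \<theta>'" "\<theta>' < real N" and eq: "boundary_pt N \<theta> = boundary_pt N \<theta>'"
  shows "\<theta> = \<theta>'"
proof -
  obtain m t where m: "m \<in> {1..N}" "0 \<le> t" "t < 1" "\<theta> = real (m - 1) + t" "boundary_pt N \<theta> = gon_edge N m t"
    using boundary_pt_cases[of N \<theta>] N \<theta> by auto
  obtain m' t' where m': "m' \<in> {1..N}" "0 \<le> t'" "t' < 1" "\<theta>' = real (m' - 1) + t'" "boundary_pt N \<theta>' = gon_edge N m' t'"
    using boundary_pt_cases[of N \<theta>'] N \<theta> by auto
  have e: "gon_edge N m t = gon_edge N m' t'" using eq m m' by simp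
  consider "t > 0" | "t' > 0" | "t = 0" "t' = 0" using m m' by linarith
  then show ?thesis
  proof cases
    case 1
    then have "m = m' \<and> t = t'" using m m' by (intro edge_eq_imp[OF N _ _ _ _ _ e]) auto
    then show ?thesis using m m' by simp
  next
    case 2
    then have "m' = m \<and> t' = t" using m m' by (intro edge_eq_imp[OF N _ _ _ _ _ e[symmetric]]) auto
    then show ?thesis using m m' by simp
  next
    case 3
    then have "m - 1 = m' - 1" using e m m' N by (intro gon_vertex_inj[of N]) auto
    then show ?thesis using 3 m m' by simp
  qed
qed

text \<open>
  The scaling factor of a point on the ray through a boundary point is recovered as the maximum of
  the heights, divided by \<open>cos (\<pi>/N)\<close> (for the bigon, as the norm).
\<close>

lemma radial_edge_le:
  assumes N: "N \<ge> 2" and m: "m \<in> {1..N}" "m' \<in> {1..N}" and t: "t \<in> {0..1}" "t' \<in> {0..1}"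
    and r: "0 \<le> r" "0 \<le> r'" and eq: "of_real r * gon_edge N m t = of_real r' * gon_edge N m' t'"
  shows "r \<le> r'"
proof (cases "N = 2")
  case True
  then have "norm (of_real r * gon_edge N m t) = r" "norm (of_real r' * gon_edge N m' t') = r'"
    using r by (simp_all add: gon_edge_def norm_mult)
  then show ?thesis using eq by simp
next
  case False
  then have N3: "N \<ge> 3" using N by simp
  have c: "0 < cos (pi / N)" using N3 by (intro cos_gt_zero) (auto simp: field_simps)
  have "r * cos (pi / N) = edge_height N m (of_real r * gon_edge N m t)"
    using edge_height_edge(2)[OF N3 m(1,1) t(1)] by (simp add: edge_height_linear)
  also have "\<dots> = r' * edge_height N m (gon_edge N m' t')"
    unfolding eq by (simp add: edge_height_linear)
  also have "\<dots> \<le> r' * cos (pi / N)"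
    using edge_height_edge(1)[OF N3 m t(2)] r by (intro mult_left_mono) auto
  finally show ?thesis using c by simp
qed

lemma polar_inj:
  assumes N: "N \<ge> 2" and \<theta>: "0 \<le> \<theta>" "\<theta> < real N" "0 \<le> \<theta>'" "\<theta>' < real N"
    and r: "0 \<le> r" "0 \<le> r'" and eq: "of_real r * boundary_pt N \<theta> = of_real r' * boundary_pt N \<theta>'"
  shows "r = r' \<and> (r = 0 \<or> \<theta> = \<theta>')"
proof -
  obtain m t where m: "m \<in> {1..N}" "0 \<le> t" "t < 1" "\<theta> = real (m - 1) + t" "boundary_pt N \<theta> = gon_edge N m t"
    using boundary_pt_cases[of N \<theta>] N \<theta> by auto
  obtain m' t' where m': "m' \<in> {1..N}" "0 \<le> t'" "t' < 1" "\<theta>' = real (m' - 1) + t'" "boundary_pt N \<theta>' = gon_edge N m' t'"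
    using boundary_pt_cases[of N \<theta>'] N \<theta> by auto
  have "r \<le> r'" using eq m m' r by (intro radial_edge_le[of N m m' t t' r r']) (auto simp: N)
  moreover have "r' \<le> r" using eq m m' r by (intro radial_edge_le[of N m' m t' t r' r]) (auto simp: N)
  ultimately have "r = r'" by simp
  then show ?thesis using eq boundary_pt_inj[OF N \<theta>] by auto
qed

lemma radial_interior:
  assumes N: "N \<ge> 2" and \<theta>: "0 \<le> \<theta>" "\<theta> < real N" and r: "0 \<le> r" "r < 1"
    and m: "m \<in> {1..N}" "t \<in> {0..1}"
  shows "of_real r * boundary_pt N \<theta> \<noteq> gon_edge N m t"
proof
  assume eq: "of_real r * boundary_pt N \<theta> = gon_edge N m t"
  obtain m' t' where m': "m' \<in> {1..N}" "0 \<le> t'" "t' < 1" "\<theta> = real (m' - 1) + t'" "boundary_pt N \<theta> = gon_edge N m' t'"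
    using boundary_pt_cases[of N \<theta>] N \<theta> by auto
  have "1 \<le> r" using eq m' r m by (intro radial_edge_le[of N m m' t t' 1 r]) (auto simp: N)
  then show False using r by simp
qed

lemma gon_vertex_mem: 
  assumes "N \<ge> 1" "k \<le> N" shows "gon_vertex N k \<in> gon N"
proof (cases "N \<le> 2")
  case False
  have "gon_vertex N k \<in> gon_vertex N ` {0..<N}"
  proof (cases "k = N")
    case True
    then have "gon_vertex N k = gon_vertex N 0" using assms by (simp add: gon_vertex_def)
    then show ?thesis using assms by auto
  qed (use assms in auto)
  then show ?thesis using False hull_subset[of "gon_vertex N ` {0..<N}" convex] by (auto simp: gon_def)
qed (simp add: gon_def gon_vertex_def)

lemma convex_gon: "convex (gon N)"
  by (simp add: gon_def convex_convex_hull)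

lemma zero_mem_gon:
  assumes "N \<ge> 2" shows "0 \<in> gon N"
proof (cases "N \<le> 2")
  case False
  have "(\<Sum>k<N. gon_vertex N k) = \<Sum>{z. z ^ N = 1}"
    using assms unfolding gon_vertex_def by (intro sum.reindex_bij_betw Complex.bij_betw_roots_unity) simp
  also have "\<dots> = 0" using assms by (intro sum_roots_unity) simp
  finally have 0: "(\<Sum>k<N. gon_vertex N k) = 0" .
  have "(\<Sum>k\<in>{..<N}. (1 / real N) *\<^sub>R gon_vertex N k) \<in> gon N"
    using assms by (intro convex_sum convex_gon) (auto intro: gon_vertex_mem)
  then show ?thesis by (simp add: 0 flip: scaleR_sum_right)
qed (simp add: gon_def)

lemma gon_edge_mem:
  assumes "m \<in> {1..N}" "t \<in> {0..1}" shows "gon_edge N m t \<in> gon N"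
proof (cases "N \<le> 2")
  case False
  have "(1 - t) *\<^sub>R gon_vertex N (m - 1) + t *\<^sub>R gon_vertex N m \<in> gon N"
    using assms by (intro convexD[OF convex_gon] gon_vertex_mem) auto
  then show ?thesis using False by (simp add: gon_edge_def scaleR_conv_of_real)
qed (simp add: gon_def gon_edge_def)

lemma radial_mem_gon:
  assumes "N \<ge> 2" "0 \<le> \<theta>" "\<theta> < real N" "0 \<le> r" "r \<le> 1"
  shows "of_real r * boundary_pt N \<theta> \<in> gon N"
proof -
  obtain m t where m: "m \<in> {1..N}" "0 \<le> t" "t < 1" "\<theta> = real (m - 1) + t" "boundary_pt N \<theta> = gon_edge N m t"
    using boundary_pt_cases[of N \<theta>] assms by auto
  have "(1 - r) *\<^sub>R 0 + r *\<^sub>R gon_edge N m t \<in> gon N"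
    using assms m by (intro convexD[OF convex_gon] zero_mem_gon gon_edge_mem) auto
  then show ?thesis unfolding m(5) by (simp add: scaleR_conv_of_real)
qed

section \<open>Points of the glued surface\<close>

lemma surf_pt_self: "p \<in> surf_pt N p"
  by (simp add: surf_pt_def equivclp_def)

lemma surf_pt_eqI:
  assumes "glue N p q" shows "surf_pt N p = surf_pt N q"
proof -
  have pq: "equivclp (glue N) p q" using assms by (simp add: r_into_equivclp)
  show ?thesis
    unfolding surf_pt_def using equivclp_trans[OF pq] equivclp_trans[OF equivclp_sym[OF pq]] by blast
qed

lemma surf_pt_subset:
  assumes "p \<in> C" and "\<And>x y. x \<in> C \<Longrightarrow> glue N x y \<or> glue N y x \<Longrightarrow> y \<in> C"
  shows "surf_pt N p \<subseteq> C"
proof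
  fix q assume "q \<in> surf_pt N p"
  then have "equivclp (glue N) p q" by (simp add: surf_pt_def)
  then show "q \<in> C" by (induction rule: equivclp_induct) (use assms in blast)+
qed

text \<open>
  The gluing affects only the points of this set, in either polygon.
\<close>

definition boundary :: "nat \<Rightarrow> complex set" where
  "boundary N = {gon_edge N m t | m t. m \<in> {1..N} \<and> t \<in> {0..1}}"

lemma surf_pt_interior:
  assumes "z \<notin> boundary N"
  shows "surf_pt N (c, z) = {(c, z)}"
proof
  show "surf_pt N (c, z) \<subseteq> {(c, z)}"
  proof (rule surf_pt_subset)
    fix x y assume x: "x \<in> {(c, z)}" and g: "glue N x y \<or> glue N y x"
    have "1 - t \<in> {0..1}" if "t \<in> {0..1}" for t :: real using that by simp
    then have "z \<in> boundary N" using x g unfolding glue_def boundary_def by blast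
    then show "y \<in> {(c, z)}" using assms by blast
  qed simp
qed (simp add: surf_pt_self)

lemma surf_pt_edge:
  assumes "m \<in> {1..N}" "t \<in> {0..1}"
  shows "surf_pt N (1, gon_edge N m t) = surf_pt N (2, gon_edge N m (1 - t))"
  by (rule surf_pt_eqI) (unfold glue_def, use assms in blast)

lemma surf_pt_open_edge:
  assumes N: "N \<ge> 2" and m: "m \<in> {1..N}" and t: "0 < t" "t < 1"
  shows "surf_pt N (1, gon_edge N m t) = {(1, gon_edge N m t), (2, gon_edge N m (1 - t))}"
proof
  show "surf_pt N (1, gon_edge N m t) \<subseteq> {(1, gon_edge N m t), (2, gon_edge N m (1 - t))}"
  proof (rule surf_pt_subset)
    fix x y assume x: "x \<in> {(1, gon_edge N m t), (2, gon_edge N m (1 - t))}"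
      and g: "glue N x y \<or> glue N y x"
    obtain m' t' where m': "m' \<in> {1..N}" "t' \<in> {0..1}"
      and xy: "{x, y} = {(1, gon_edge N m' t'), (2, gon_edge N m' (1 - t'))}"
      using g unfolding glue_def by blast
    have "gon_edge N m t = gon_edge N m' t' \<or> gon_edge N m (1 - t) = gon_edge N m' (1 - t')"
      using x xy by (auto simp: doubleton_eq_iff)
    then have "m = m' \<and> t = t'"
    proof
      assume "gon_edge N m t = gon_edge N m' t'"
      then show ?thesis by (rule edge_eq_imp[OF N m m'(1) t m'(2)])
    next
      assume "gon_edge N m (1 - t) = gon_edge N m' (1 - t')"
      then have "m = m' \<and> 1 - t = 1 - t'" using m' t by (intro edge_eq_imp[OF N m m'(1)]) auto
      then show ?thesis by simp
    qed
    then show "y \<in> {(1, gon_edge N m t), (2, gon_edge N m (1 - t))}" using xy by blast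
  qed simp
next
  have "(2, gon_edge N m (1 - t)) \<in> surf_pt N (1, gon_edge N m t)"
    using surf_pt_self[of "(2, gon_edge N m (1 - t))" N] surf_pt_edge[OF m, of t] t by simp
  then show "{(1, gon_edge N m t), (2, gon_edge N m (1 - t))} \<subseteq> surf_pt N (1, gon_edge N m t)"
    by (simp add: surf_pt_self)
qed

lemma gon_vertex_boundary:
  assumes "k < N" shows "gon_vertex N k \<in> boundary N"
proof -
  have "gon_vertex N k = gon_edge N (Suc k) 0" "Suc k \<in> {1..N}" "(0::real) \<in> {0..1}"
    using assms by simp_all
  then show ?thesis unfolding boundary_def by blast
qed

lemma interior_notin_T: 
  assumes "z \<notin> boundary N" shows "surf_pt N (c, z) \<notin> T_all N \<sigma>"
proof
  assume "surf_pt N (c, z) \<in> T_all N \<sigma>"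
  then obtain m t where "m \<in> {1..N}" "t \<in> {0..1}" "surf_pt N (c, z) = surf_pt N (1, gon_edge N m t)"
    by (auto simp: T_all_def T_edge_def)
  then have "(1, gon_edge N m t) \<in> {(c, z)}"
    using surf_pt_self[of "(1, gon_edge N m t)" N] surf_pt_interior[OF assms] by metis
  then show False using assms \<open>m \<in> {1..N}\<close> \<open>t \<in> {0..1}\<close> by (auto simp: boundary_def)
qed

lemma interior_notin_V:
  assumes "z \<notin> boundary N" shows "surf_pt N (c, z) \<notin> V_pts N"
proof
  assume "surf_pt N (c, z) \<in> V_pts N"
  then obtain i k where k: "k < N" "surf_pt N (c, z) = surf_pt N (i, gon_vertex N k)"
    by (auto simp: V_pts_def)
  then have "(i, gon_vertex N k) \<in> {(c, z)}"
    using surf_pt_self[of "(i, gon_vertex N k)" N] surf_pt_interior[OF assms] by metis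
  then show False using assms gon_vertex_boundary[OF k(1)] by simp
qed

lemma interior_mem_face:
  assumes "z \<in> gon N" "z \<notin> boundary N" shows "surf_pt N (c, z) \<in> face N \<sigma> c"
  using assms interior_notin_T by (auto simp: face_def)

lemma open_edge_notin_V:
  assumes N: "N \<ge> 2" and m: "m \<in> {1..N}" and t: "0 < t" "t < 1"
  shows "surf_pt N (1, gon_edge N m t) \<notin> V_pts N"
proof
  assume "surf_pt N (1, gon_edge N m t) \<in> V_pts N"
  then obtain i k where k: "k < N" "surf_pt N (1, gon_edge N m t) = surf_pt N (i, gon_vertex N k)"
    by (auto simp: V_pts_def)
  then have "(i, gon_vertex N k) \<in> {(1, gon_edge N m t), (2, gon_edge N m (1 - t))}"
    using surf_pt_self[of "(i, gon_vertex N k)" N] surf_pt_open_edge[OF N m t] by simp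
  then have "gon_edge N m t = gon_edge N (Suc k) 0 \<or> gon_edge N m (1 - t) = gon_edge N (Suc k) 0"
    by auto
  then show False
  proof
    assume "gon_edge N m t = gon_edge N (Suc k) 0"
    then show False using edge_eq_imp[OF N m, of "Suc k" t 0] k t by auto
  next
    assume "gon_edge N m (1 - t) = gon_edge N (Suc k) 0"
    then show False using edge_eq_imp[OF N m, of "Suc k" "1 - t" 0] k t by auto
  qed
qed

lemma open_edge_mem_T_edge_iff:
  assumes N: "N \<ge> 2" and m: "m \<in> {1..N}" and t: "0 < t" "t < 1"
  shows "surf_pt N (1, gon_edge N m t) \<in> T_edge N id i \<longleftrightarrow> i = m"
proof
  assume "surf_pt N (1, gon_edge N m t) \<in> T_edge N id i"
  then obtain t' where t': "i \<in> {1..N}" "t' \<in> {0..1}"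
      "surf_pt N (1, gon_edge N m t) = surf_pt N (1, gon_edge N i t')"
    by (auto simp: T_edge_def)
  then have "(1::nat, gon_edge N i t') \<in> {(1, gon_edge N m t), (2, gon_edge N m (1 - t))}"
    using surf_pt_self[of "(1, gon_edge N i t')" N] surf_pt_open_edge[OF N m t] by simp
  then have "gon_edge N m t = gon_edge N i t'" by auto
  then show "i = m" using edge_eq_imp[OF N m t'(1) t t'(2)] by simp
next
  assume "i = m"
  then show "surf_pt N (1, gon_edge N m t) \<in> T_edge N id i"
    unfolding T_edge_def using m t by force
qed

lemma continuous_surf_pt: "continuous_map (top_of_set (two_gons N)) (surface N) (surf_pt N)"
proof -
  have "topspace (surface N) = surf_pt N ` two_gons N"
  proof -
    have "{x \<in> two_gons N. surf_pt N x \<in> surf_pt N ` two_gons N} = two_gons N" by blast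
    then have "openin (surface N) (surf_pt N ` two_gons N)"
      unfolding surface_def openin_quotient_topology by simp
    moreover have "U \<subseteq> surf_pt N ` two_gons N" if "openin (surface N) U" for U
      using that unfolding surface_def openin_quotient_topology by simp
    ultimately show ?thesis by (metis openin_subset openin_topspace subset_antisym)
  qed
  then show ?thesis
    unfolding continuous_map_def by (auto simp: surface_def openin_quotient_topology)
qed

section \<open>The zigzag curve\<close>

text \<open>
  For fixed \<open>i\<close> and \<open>d\<close> the curve crosses \<open>T\<^sub>i, T\<^sub>i\<^sub>+\<^sub>1, \<dots>, T\<^sub>i\<^sub>+\<^sub>d, \<dots>, T\<^sub>i\<^sub>+\<^sub>1, T\<^sub>i\<close>.  These \<open>2d + 1\<close> crossings
  divide it into \<open>K = 2d + 2\<close> pieces, which lie alternately in \<open>G\<^sub>1\<close> and \<open>G\<^sub>2\<close>.  The \<open>k\<close>-th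
  crossing takes place at time \<open>k/K\<close>, and also at the parameter \<open>k/K\<close> of the edge, measured in the
  polygon that the curve is leaving; in the polygon that it enters this is \<open>1 - k/K\<close>.  Thus the
  middle crossing is at the midpoint of its edge, as the symmetry requires.
\<close>

locale zigzag =
  fixes N i d :: nat
  assumes N: "2 \<le> N" and i: "1 \<le> i" and iN: "i + d \<le> N"
begin

definition K :: real where "K = 2 * real d + 2"

text \<open>
  Piece 0 runs along two radii of the polygon.  Piece \<open>k\<close>, for \<open>1 \<le> k \<le> d\<close>, cuts off the corner
  between the edges \<open>i + k - 1\<close> and \<open>i + k\<close>; the quadratic keeps its radius positive, and
  below 1 except at its ends.
\<close>

definition polar_radius :: "nat \<Rightarrow> real \<Rightarrow> real" where
  "polar_radius k s = (if k = 0 then \<bar>1 - 2 * s\<bar> else 1 - s * (1 - s))"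

definition polar_angle :: "nat \<Rightarrow> real \<Rightarrow> real" where
  "polar_angle k s = (if k = 0 then (if s \<le> 1/2 then 0 else real i - 1 + 1 / K)
     else real i + real k - 1 - real k / K + s * (real k / K + (real k + 1) / K))"

definition half :: "nat \<Rightarrow> real \<Rightarrow> complex" where
  "half k s = of_real (polar_radius k s) * boundary_pt N (polar_angle k s)"

text \<open>
  The second half of the curve is the first one reversed.  Piece \<open>k\<close> and its mirror image \<open>2d + 1 - k\<close>
  lie in different polygons.
\<close>

definition piece :: "nat \<Rightarrow> real \<Rightarrow> complex" where
  "piece k s = (if k \<le> d then half k s else half (2 * d + 1 - k) (1 - s))"

definition side :: "nat \<Rightarrow> nat" where
  "side k = (if even k then 1 else 2)"

definition edge_label :: "nat \<Rightarrow> nat" where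
  "edge_label k = i + min (k - 1) (2 * d + 1 - k)"

definition crossing :: "nat \<Rightarrow> (nat \<times> complex) set" where
  "crossing k = surf_pt N (1, gon_edge N (edge_label k) (if odd k then real k / K else 1 - real k / K))"

text \<open>
  The minimum assigns the time 1 to the last piece.
\<close>

definition curve :: "real \<Rightarrow> (nat \<times> complex) set" where
  "curve x = (let k = min (nat \<lfloor>K * x\<rfloor>) (2 * d + 1) in surf_pt N (side k, piece k (K * x - real k)))"

lemma K_pos: "K > 0" and K_ge_2: "K \<ge> 2"
  by (simp_all add: K_def)

lemma frac_le:
  assumes "k \<le> d"
  shows "0 \<le> real k / K" "real k / K < 1 / 2" "0 < (real k + 1) / K" "(real k + 1) / K \<le> 1 / 2"
  using assms by (auto simp: K_def field_simps)

lemma edge_label_range: "1 \<le> k \<Longrightarrow> k \<le> 2 * d + 1 \<Longrightarrow> edge_label k \<in> {1..N}"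
  using i iN by (auto simp: edge_label_def)

lemma inv_K: "0 < 1 / K" "1 / K \<le> 1 / 2"
  using K_ge_2 by (auto simp: field_simps)

lemma polar_angle_bounds:
  assumes "1 \<le> k" "k \<le> d" "0 \<le> s" "s \<le> 1"
  shows "real i + real k - 3 / 2 < polar_angle k s" "polar_angle k s \<le> real i + real k - 1 / 2"
proof -
  define p q where "p = real k / K" and "q = (real k + 1) / K"
  have pq: "0 \<le> p" "p < 1 / 2" "0 < q" "q \<le> 1 / 2"
    unfolding p_def q_def by (rule frac_le[OF assms(2)])+
  define w where "w = s * (p + q)"
  have a: "polar_angle k s = real i + real k - 1 - p + w"
    using assms(1) by (simp add: polar_angle_def p_def q_def w_def)
  have "0 \<le> w" "w \<le> p + q"
    unfolding w_def using pq assms by (simp_all add: mult_left_le_one_le)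
  then show "real i + real k - 3 / 2 < polar_angle k s" "polar_angle k s \<le> real i + real k - 1 / 2"
    unfolding a using pq by - linarith+
qed

lemma polar_angle_zero_bounds: "0 \<le> polar_angle 0 s" "polar_angle 0 s \<le> real i - 1 / 2"
proof -
  have "1 \<le> real i" using i by simp
  moreover have "polar_angle 0 s = 0 \<or> polar_angle 0 s = real i - 1 + 1 / K" by (simp add: polar_angle_def)
  ultimately show "0 \<le> polar_angle 0 s" "polar_angle 0 s \<le> real i - 1 / 2" using inv_K by - ((elim disjE; linarith)+)
qed

lemma polar_angle_range:
  assumes "k \<le> d" "0 \<le> s" "s \<le> 1"
  shows "0 \<le> polar_angle k s" "polar_angle k s < real N"
proof -
  have *: "1 \<le> real i" "real i + real k \<le> real N" using i iN assms(1) by simp_all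
  show "0 \<le> polar_angle k s"
    using polar_angle_bounds(1)[of k s] polar_angle_zero_bounds(1)[of s] assms * by (cases "k = 0") auto
  show "polar_angle k s < real N"
    using polar_angle_bounds(2)[of k s] polar_angle_zero_bounds(2)[of s] assms * by (cases "k = 0") auto
qed

lemma dent:
  assumes "0 \<le> s" "s \<le> (1::real)"
  shows "0 < 1 - s * (1 - s)" "1 - s * (1 - s) \<le> 1" "0 < s \<Longrightarrow> s < 1 \<Longrightarrow> 1 - s * (1 - s) < 1"
proof -
  have "1 - s * (1 - s) = (s - 1 / 2)\<^sup>2 + 3 / 4" by (simp add: power2_eq_square algebra_simps)
  then show "0 < 1 - s * (1 - s)" using zero_le_power2[of "s - 1 / 2"] by linarith
  have "0 \<le> s * (1 - s)" using assms by simp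
  then show "1 - s * (1 - s) \<le> 1" by linarith
  assume "0 < s" "s < 1"
  then have "0 < s * (1 - s)" by simp
  then show "1 - s * (1 - s) < 1" by linarith
qed

lemma polar_radius_range:
  assumes "0 \<le> s" "s \<le> 1"
  shows "0 \<le> polar_radius k s" "polar_radius k s \<le> 1" "0 < s \<Longrightarrow> s < 1 \<Longrightarrow> polar_radius k s < 1"
  using dent[OF assms] assms by (auto simp: polar_radius_def)

lemma polar_radius_eq_0_iff: "0 \<le> s \<Longrightarrow> s \<le> 1 \<Longrightarrow> polar_radius k s = 0 \<longleftrightarrow> k = 0 \<and> s = 1 / 2"
  using dent(1)[of s] by (auto simp: polar_radius_def)

text \<open>
  The sector of piece \<open>k \<ge> 1\<close> extends by at most half an edge to either side of vertex
  \<open>i + k - 1\<close>, and piece 0 stays before all of these sectors.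
\<close>

lemma half_inj:
  assumes k: "k \<le> d" "k' \<le> d" and s: "0 < s" "s < 1" "0 < s'" "s' < 1" and eq: "half k s = half k' s'"
  shows "k = k' \<and> s = s'"
proof -
  have "polar_radius k s = polar_radius k' s' \<and> (polar_radius k s = 0 \<or> polar_angle k s = polar_angle k' s')"
    by (rule polar_inj[OF N]) (use eq k s in \<open>simp_all add: polar_angle_range polar_radius_range half_def\<close>)
  then have r: "polar_radius k s = polar_radius k' s'" and a: "polar_radius k s = 0 \<or> polar_angle k s = polar_angle k' s'" by blast+
  show ?thesis
  proof (cases "polar_radius k s = 0")
    case True
    then show ?thesis using polar_radius_eq_0_iff[of s k] polar_radius_eq_0_iff[of s' k'] r s by simp
  next
    case False
    then have a: "polar_angle k s = polar_angle k' s'" using a by simp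
    have sep: False if "k1 < k2" "k2 \<le> d" "polar_angle k1 s1 = polar_angle k2 s2" "0 < s1" "s1 < 1" "0 < s2" "s2 < 1"
      for k1 k2 s1 s2
      using polar_angle_bounds(1)[of k2 s2] polar_angle_bounds(2)[of k1 s1] polar_angle_zero_bounds(2)[of s1] that
      by (cases "k1 = 0") auto
    have kk: "k = k'"
      using sep[of k k' s s'] sep[of k' k s' s] a k s by (cases k k' rule: linorder_cases) auto
    show ?thesis
    proof (cases "k = 0")
      case True
      have "real i - 1 + 1 / K \<noteq> 0" using i inv_K by linarith
      then have "s \<le> 1/2 \<longleftrightarrow> s' \<le> 1/2" using a True kk by (auto simp: polar_angle_def split: if_splits)
      then show ?thesis using r True kk by (auto simp: polar_radius_def)
    next
      case False
      have "0 < real k / K + (real k + 1) / K" using frac_le[OF k(1)] by linarith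
      then show ?thesis using a False kk by (simp add: polar_angle_def)
    qed
  qed
qed

lemma half_mem_gon: "k \<le> d \<Longrightarrow> 0 \<le> s \<Longrightarrow> s \<le> 1 \<Longrightarrow> half k s \<in> gon N"
  unfolding half_def by (intro radial_mem_gon N polar_angle_range polar_radius_range)

lemma half_notin_boundary:
  assumes "k \<le> d" "0 < s" "s < 1" shows "half k s \<notin> boundary N"
proof -
  have "half k s \<noteq> gon_edge N m t" if "m \<in> {1..N}" "t \<in> {0..1}" for m t
    unfolding half_def
    by (rule radial_interior[OF N _ _ _ _ that]) (use assms in \<open>simp_all add: polar_angle_range polar_radius_range\<close>)
  then show ?thesis by (auto simp: boundary_def)
qed

lemma continuous_half: "continuous_on UNIV (half k)"
proof (cases "k = 0")
  case True
  have "half k = (\<lambda>s. of_real (max 0 (1 - 2 * s)) * boundary_pt N 0 + of_real (max 0 (2 * s - 1)) * boundary_pt N (real i - 1 + 1 / K))"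
    using True by (auto simp: half_def polar_radius_def polar_angle_def fun_eq_iff max_def)
  then show ?thesis by (auto intro!: continuous_intros)
next
  case False
  then have "half k = (\<lambda>s. of_real (1 - s * (1 - s)) *
      boundary_pt N (real i + real k - 1 - real k / K + s * (real k / K + (real k + 1) / K)))"
    by (auto simp: half_def polar_radius_def polar_angle_def)
  then show ?thesis by (auto intro!: continuous_intros continuous_on_compose2[OF continuous_boundary_pt])
qed

lemma boundary_pt_edge': "m \<in> {1..N} \<Longrightarrow> t \<in> {0..1} \<Longrightarrow> \<theta> = real m - 1 + t \<Longrightarrow> boundary_pt N \<theta> = gon_edge N m t"
  using boundary_pt_edge[of m N t] by (simp add: of_nat_diff)

lemma half_ends:
  "half 0 0 = gon_vertex N 0"
  "k \<le> d \<Longrightarrow> half k 1 = gon_edge N (i + k) ((real k + 1) / K)"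
  "1 \<le> k \<Longrightarrow> k \<le> d \<Longrightarrow> half k 0 = gon_edge N (i + k - 1) (1 - real k / K)"
proof -
  have "boundary_pt N 0 = gon_edge N 1 0" using N by (intro boundary_pt_edge') auto
  then show "half 0 0 = gon_vertex N 0" by (simp add: half_def polar_radius_def polar_angle_def)
  show "half k 1 = gon_edge N (i + k) ((real k + 1) / K)" if "k \<le> d"
  proof -
    have "(real k + 1) / K \<in> {0..1}"
      using frac_le[OF that] unfolding atLeastAtMost_iff by linarith
    then have "boundary_pt N (polar_angle k 1) = gon_edge N (i + k) ((real k + 1) / K)"
      using that i iN inv_K by (intro boundary_pt_edge') (simp_all add: polar_angle_def)
    then show ?thesis by (simp add: half_def polar_radius_def)
  qed
  show "half k 0 = gon_edge N (i + k - 1) (1 - real k / K)" if k: "1 \<le> k" "k \<le> d"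
  proof -
    have "1 - real k / K \<in> {0..1}"
      using frac_le[OF k(2)] unfolding atLeastAtMost_iff by linarith
    moreover have "i + k - 1 \<in> {1..N}" using k i iN unfolding atLeastAtMost_iff by arith
    ultimately have "boundary_pt N (polar_angle k 0) = gon_edge N (i + k - 1) (1 - real k / K)"
      using k i by (intro boundary_pt_edge') (simp_all add: polar_angle_def of_nat_diff)
    then show ?thesis using k by (simp add: half_def polar_radius_def)
  qed
qed

lemma piece_start:
  assumes k: "1 \<le> k" "k \<le> 2 * d + 1"
  shows "piece k 0 = gon_edge N (edge_label k) (1 - real k / K)"
proof (cases "k \<le> d")
  case True
  have "edge_label k = i + k - 1" using True k by (simp add: edge_label_def)
  then show ?thesis using True k by (simp add: piece_def half_ends)
next
  case False
  define k' where "k' = 2 * d + 1 - k"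
  have k': "k' \<le> d" "real k' = 2 * real d + 1 - real k" using False k by (auto simp: k'_def of_nat_diff)
  have "edge_label k = i + k'" using False k by (simp add: edge_label_def k'_def)
  moreover have "(real k' + 1) / K = 1 - real k / K"
    using K_pos k'(2) by (simp add: field_simps) (simp add: K_def)
  ultimately show ?thesis using False half_ends(2)[OF k'(1)] by (simp add: piece_def k'_def)
qed

lemma piece_end:
  assumes k: "k \<le> 2 * d"
  shows "piece k 1 = gon_edge N (edge_label (Suc k)) (real (Suc k) / K)"
proof (cases "k \<le> d")
  case True
  have "edge_label (Suc k) = i + k" using True by (simp add: edge_label_def)
  then show ?thesis using True by (simp add: piece_def half_ends add.commute)
next
  case False
  define k' where "k' = 2 * d + 1 - k"
  have k': "1 \<le> k'" "k' \<le> d" "real k' = 2 * real d + 1 - real k" using False k by (auto simp: k'_def of_nat_diff)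
  have "edge_label (Suc k) = i + k' - 1" using False k by (simp add: edge_label_def k'_def)
  moreover have "1 - real k' / K = real (Suc k) / K"
    using K_pos k'(3) by (simp add: field_simps) (simp add: K_def)
  ultimately show ?thesis using False half_ends(3)[OF k'(1,2)] by (simp add: piece_def k'_def)
qed

lemma piece_extremes: "piece 0 0 = gon_vertex N 0" "piece (2 * d + 1) 1 = gon_vertex N 0"
  by (simp_all add: piece_def half_ends)

lemma crossing_pos: "1 \<le> k \<Longrightarrow> k \<le> 2 * d + 1 \<Longrightarrow> 0 < real k / K" "k \<le> 2 * d + 1 \<Longrightarrow> real k / K < 1"
  using K_pos by (auto simp: K_def field_simps)

text \<open>
  Since leaving and entering positions are \<open>k/K\<close> and \<open>1 - k/K\<close>, consecutive pieces fit together
  under the gluing.  The point is named by its representative in \<open>G\<^sub>1\<close>, which the curve leaves at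
  the odd crossings and enters at the even ones.
\<close>

lemma crossing_eq:
  assumes k: "1 \<le> k" "k \<le> 2 * d + 1"
  shows "surf_pt N (side k, piece k 0) = crossing k"
    and "surf_pt N (side (k - 1), piece (k - 1) 1) = crossing k"
proof -
  have t: "real k / K \<in> {0..1}" "1 - real k / K \<in> {0..1}" using crossing_pos[of k] k by auto
  have e: "piece k 0 = gon_edge N (edge_label k) (1 - real k / K)" by (rule piece_start[OF k])
  have e': "piece (k - 1) 1 = gon_edge N (edge_label k) (real k / K)" using piece_end[of "k - 1"] k by simp
  have l: "edge_label k \<in> {1..N}" by (rule edge_label_range[OF k])
  show "surf_pt N (side k, piece k 0) = crossing k"
    using surf_pt_edge[OF l t(1)] by (simp add: e crossing_def side_def)
  show "surf_pt N (side (k - 1), piece (k - 1) 1) = crossing k"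
  proof (cases "odd k")
    case True
    then have "side (k - 1) = 1" using k by (simp add: side_def)
    then show ?thesis using True unfolding e' crossing_def by simp
  next
    case False
    then have "side (k - 1) = 2" using k by (simp add: side_def)
    moreover have "1 - (1 - real k / K) = real k / K" by simp
    ultimately show ?thesis using False surf_pt_edge[OF l t(2)] unfolding e' crossing_def by simp
  qed
qed

lemma curve_piece:
  assumes k: "k \<le> 2 * d + 1" and s: "0 \<le> s" "s \<le> 1"
  shows "curve ((real k + s) / K) = surf_pt N (side k, piece k s)"
proof -
  have x: "K * ((real k + s) / K) = real k + s" using K_pos by simp
  show ?thesis
  proof (cases "s < 1")
    case True
    then have "nat \<lfloor>real k + s\<rfloor> = k" using s by linarith
    then have m: "min (nat \<lfloor>real k + s\<rfloor>) (2 * d + 1) = k" using k by simp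
    show ?thesis unfolding curve_def x Let_def m by simp
  next
    case False
    then have s1: "s = 1" using s by simp
    have fl: "nat \<lfloor>real k + s\<rfloor> = Suc k" using s1 by linarith
    show ?thesis
    proof (cases "k = 2 * d + 1")
      case True
      then have m: "min (nat \<lfloor>real k + s\<rfloor>) (2 * d + 1) = k" using fl by simp
      show ?thesis unfolding curve_def x Let_def m by simp
    next
      case False
      then have m: "min (nat \<lfloor>real k + s\<rfloor>) (2 * d + 1) = Suc k" using fl k by simp
      have "curve ((real k + s) / K) = surf_pt N (side (Suc k), piece (Suc k) 0)"
        unfolding curve_def x Let_def m by (simp add: s1)
      then show ?thesis using crossing_eq[of "Suc k"] False k s1 by simp
    qed
  qed
qed

lemma curve_crossing: "1 \<le> k \<Longrightarrow> k \<le> 2 * d + 1 \<Longrightarrow> curve (real k / K) = crossing k"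
  using curve_piece[of k 0] crossing_eq(1)[of k] by simp

lemma time_cases:
  assumes "x \<in> {0..1}"
  obtains (ends) "x \<in> {0, 1}"
    | (crossing) k where "1 \<le> k" "k \<le> 2 * d + 1" "x = real k / K"
    | (inside) k s where "k \<le> 2 * d + 1" "0 < s" "s < 1" "x = (real k + s) / K"
proof -
  define k where "k = nat \<lfloor>K * x\<rfloor>"
  define s where "s = K * x - real k"
  have Kx: "0 \<le> K * x" "K * x \<le> 2 * real d + 2"
    using assms K_pos mult_left_le[of x K] by (auto simp: K_def)
  have s: "0 \<le> s" "s < 1" using Kx unfolding s_def k_def by linarith+
  have x: "x = (real k + s) / K" using K_pos by (simp add: s_def field_simps)
  have k: "k \<le> 2 * d + 2" using Kx s by (simp add: s_def)
  consider "x \<in> {0, 1}" | "s = 0" "x \<notin> {0, 1}" | "0 < s" using s by linarith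
  then show ?thesis
  proof cases
    case 2
    then have "k \<noteq> 0" "k \<noteq> 2 * d + 2" using x K_pos by (auto simp: K_def)
    then show ?thesis using crossing[of k] 2 k x by simp
  next
    case 3
    then have "k \<noteq> 2 * d + 2" using Kx by (auto simp: s_def)
    then show ?thesis using inside[of k s] 3 s k x by simp
  qed (rule ends)
qed

lemma piece_mem_gon: "k \<le> 2 * d + 1 \<Longrightarrow> 0 \<le> s \<Longrightarrow> s \<le> 1 \<Longrightarrow> piece k s \<in> gon N"
  by (auto simp: piece_def intro!: half_mem_gon)

lemma piece_notin_boundary: "k \<le> 2 * d + 1 \<Longrightarrow> 0 < s \<Longrightarrow> s < 1 \<Longrightarrow> piece k s \<notin> boundary N"
  using half_notin_boundary by (auto simp: piece_def)

lemma continuous_piece: "continuous_on UNIV (piece k)"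
proof (cases "k \<le> d")
  case True
  then have "piece k = half k" by (auto simp: piece_def)
  then show ?thesis by (simp add: continuous_half)
next
  case False
  then have "piece k = (\<lambda>s. half (2 * d + 1 - k) (1 - s))" by (auto simp: piece_def)
  then show ?thesis by (auto intro!: continuous_on_compose2[OF continuous_half] continuous_intros)
qed

lemma piece_inj:
  assumes k: "k \<le> 2 * d + 1" "k' \<le> 2 * d + 1" and s: "0 < s" "s < 1" "0 < s'" "s' < 1"
    and eq: "side k = side k'" "piece k s = piece k' s'"
  shows "k = k' \<and> s = s'"
proof -
  have par: "even k \<longleftrightarrow> even k'" using eq(1) by (auto simp: side_def split: if_splits)
  consider "k \<le> d" "k' \<le> d" | "k \<le> d" "d < k'" | "d < k" "k' \<le> d" | "d < k" "d < k'" by linarith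
  then show ?thesis
  proof cases
    case 1
    then show ?thesis using half_inj[of k k' s s'] eq s by (simp add: piece_def)
  next
    case 2
    then have "k = 2 * d + 1 - k'" using half_inj[of k "2 * d + 1 - k'" s "1 - s'"] eq s by (simp add: piece_def)
    then have "k + k' = 2 * d + 1" using k by simp
    then show ?thesis using par by presburger
  next
    case 3
    then have "k' = 2 * d + 1 - k" using half_inj[of k' "2 * d + 1 - k" s' "1 - s"] eq s by (simp add: piece_def)
    then have "k + k' = 2 * d + 1" using k by simp
    then show ?thesis using par by presburger
  next
    case 4
    then have "2 * d + 1 - k = 2 * d + 1 - k' \<and> 1 - s = 1 - s'"
      using eq s by (intro half_inj) (simp_all add: piece_def)
    then show ?thesis using k by auto
  qed
qed

lemma crossing_open_edge:
  assumes "1 \<le> k" "k \<le> 2 * d + 1"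
  obtains t where "0 < t" "t < 1" "t = (if odd k then real k / K else 1 - real k / K)"
    "crossing k = surf_pt N (1, gon_edge N (edge_label k) t)"
  using that crossing_pos[of k] assms by (auto simp: crossing_def)

text \<open>
  An edge is crossed twice only at crossings \<open>k\<close> and \<open>2d + 2 - k\<close>, which have the same parity, so
  that the positions \<open>k/K\<close> of the two can be compared in the same polygon.
\<close>

lemma crossing_inj:
  assumes k: "1 \<le> k" "k \<le> 2 * d + 1" "1 \<le> k'" "k' \<le> 2 * d + 1" and eq: "crossing k = crossing k'"
  shows "k = k'"
proof -
  obtain t where t: "0 < t" "t < 1" "t = (if odd k then real k / K else 1 - real k / K)"
    "crossing k = surf_pt N (1, gon_edge N (edge_label k) t)" using crossing_open_edge[OF k(1,2)] .
  obtain t' where t': "0 < t'" "t' < 1" "t' = (if odd k' then real k' / K else 1 - real k' / K)"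
    "crossing k' = surf_pt N (1, gon_edge N (edge_label k') t')" using crossing_open_edge[OF k(3,4)] .
  have "(1::nat, gon_edge N (edge_label k) t) \<in> {(1, gon_edge N (edge_label k') t'), (2, gon_edge N (edge_label k') (1 - t'))}"
    using surf_pt_self[of "(1, gon_edge N (edge_label k) t)" N] eq t(4) t'(4)
      surf_pt_open_edge[OF N edge_label_range[OF k(3,4)] t'(1,2)] by simp
  then have e: "gon_edge N (edge_label k) t = gon_edge N (edge_label k') t'" by simp
  have "t' \<in> {0..1}" using t'(1,2) by simp
  then have lt: "edge_label k = edge_label k' \<and> t = t'"
    by (rule edge_eq_imp[OF N edge_label_range[OF k(1,2)] edge_label_range[OF k(3,4)] t(1,2) _ e])
  then have "min (k - 1) (2 * d + 1 - k) = min (k' - 1) (2 * d + 1 - k')" by (simp add: edge_label_def)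
  then have "k = k' \<or> k + k' = 2 * d + 2" using k by (auto simp: min_def split: if_splits)
  then have "odd k \<longleftrightarrow> odd k'" by presburger
  then have "real k / K = real k' / K" using lt t(3) t'(3) by (auto split: if_splits)
  then show ?thesis using K_pos by simp
qed

lemma curve_inside:
  assumes "k \<le> 2 * d + 1" "0 < s" "s < 1"
  shows "curve ((real k + s) / K) = {(side k, piece k s)}"
    and "curve ((real k + s) / K) \<in> face N \<sigma> (side k)"
    and "curve ((real k + s) / K) \<notin> T_all N \<sigma>"
    and "curve ((real k + s) / K) \<notin> V_pts N"
proof -
  have c: "curve ((real k + s) / K) = surf_pt N (side k, piece k s)" and m: "piece k s \<in> gon N"
    using assms by (simp_all add: curve_piece piece_mem_gon)
  have b: "piece k s \<notin> boundary N" using assms by (rule piece_notin_boundary)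
  show "curve ((real k + s) / K) = {(side k, piece k s)}"
    unfolding c by (rule surf_pt_interior[OF b])
  show "curve ((real k + s) / K) \<in> face N \<sigma> (side k)"
    unfolding c by (rule interior_mem_face[OF m b])
  show "curve ((real k + s) / K) \<notin> T_all N \<sigma>"
    unfolding c by (rule interior_notin_T[OF b])
  show "curve ((real k + s) / K) \<notin> V_pts N"
    unfolding c by (rule interior_notin_V[OF b])
qed

lemma curve_ends: "curve 0 = surf_pt N (1, gon_vertex N 0)" "curve 1 = surf_pt N (2, gon_vertex N 0)"
proof -
  show "curve 0 = surf_pt N (1, gon_vertex N 0)"
    using curve_piece[of 0 0] by (simp add: piece_extremes side_def)
  have "(real (2 * d + 1) + 1) / K = 1" using K_pos by (simp add: K_def)
  then show "curve 1 = surf_pt N (2, gon_vertex N 0)"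
    using curve_piece[of "2 * d + 1" 1] piece_extremes(2) by (simp add: side_def)
qed

lemma vertex_mem_V: "surf_pt N (1, gon_vertex N 0) \<in> V_pts N" "surf_pt N (2, gon_vertex N 0) \<in> V_pts N"
  using N by (auto simp: V_pts_def)

lemma crossing_notin_V: 
  assumes "1 \<le> k" "k \<le> 2 * d + 1" shows "crossing k \<notin> V_pts N"
  using crossing_open_edge[OF assms] open_edge_notin_V[OF N edge_label_range[OF assms]] by metis

lemma crossing_mem_T_edge_iff: 
  assumes "1 \<le> k" "k \<le> 2 * d + 1" shows "crossing k \<in> T_edge N id j \<longleftrightarrow> j = edge_label k"
  using crossing_open_edge[OF assms] open_edge_mem_T_edge_iff[OF N edge_label_range[OF assms]] by metis

lemma crossing_mem_T: 
  assumes "1 \<le> k" "k \<le> 2 * d + 1" shows "crossing k \<in> T_all N id"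
  using crossing_mem_T_edge_iff[OF assms] edge_label_range[OF assms] by (auto simp: T_all_def)

lemma curve_V_iff:
  assumes "x \<in> {0..1}" shows "curve x \<in> V_pts N \<longleftrightarrow> x \<in> {0, 1}"
  using assms
proof (cases rule: time_cases)
  case ends
  then show ?thesis using curve_ends vertex_mem_V by auto
next
  case (crossing k)
  then have "x \<noteq> 0" "x \<noteq> 1" using crossing_pos[of k] by auto
  then show ?thesis using crossing crossing_notin_V[of k] curve_crossing[of k] by simp
next
  case (inside k s)
  have "real k + s < K" using inside by (simp add: K_def)
  then have "x \<noteq> 0" "x \<noteq> 1" using inside K_pos by auto
  then show ?thesis using inside curve_inside(4)[of k s] by simp
qed

lemma curve_path: "pathin (surface N) curve"
proof -
  define J where "J k = {real k / K .. (real k + 1) / K}" for k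
  have cont: "continuous_map (subtopology (top_of_set {0..1}) (J k)) (surface N)
      (\<lambda>x. surf_pt N (side k, piece k (K * x - real k)))" if k: "k \<in> {..2 * d + 1}" for k
  proof -
    have "continuous_map (top_of_set ({0..1} \<inter> J k)) (top_of_set (two_gons N))
        (\<lambda>x. (side k, piece k (K * x - real k)))"
      unfolding continuous_map_subtopology_eu image_subset_iff_funcset[symmetric]
    proof
      show "continuous_on ({0..1} \<inter> J k) (\<lambda>x. (side k, piece k (K * x - real k)))"
        by (intro continuous_intros continuous_on_compose2[OF continuous_piece]) auto
      show "(\<lambda>x. (side k, piece k (K * x - real k))) ` ({0..1} \<inter> J k) \<subseteq> two_gons N"
      proof (rule image_subsetI)
        fix x assume "x \<in> {0..1} \<inter> J k"
        then have "0 \<le> K * x - real k" "K * x - real k \<le> 1"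
          using K_pos by (auto simp: J_def field_simps)
        then show "(side k, piece k (K * x - real k)) \<in> two_gons N"
          using piece_mem_gon k by (auto simp: two_gons_def side_def)
      qed
    qed
    from continuous_map_compose[OF this continuous_surf_pt] show ?thesis
      by (simp add: o_def subtopology_subtopology)
  qed
  have on_J: "curve x = surf_pt N (side k, piece k (K * x - real k))" if "k \<in> {..2 * d + 1}" "x \<in> J k" for k x
  proof -
    have "0 \<le> K * x - real k" "K * x - real k \<le> 1"
      using that K_pos by (auto simp: J_def field_simps)
    then show ?thesis using curve_piece[of k "K * x - real k"] that K_pos by simp
  qed
  have cover: "\<exists>k. k \<in> {..2 * d + 1} \<and> x \<in> J k" if "x \<in> {0..1}" for x
    using that
  proof (cases rule: time_cases)
    case ends
    then show ?thesis
    proof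
      assume "x = 0" then show ?thesis using K_pos by (intro exI[of _ 0]) (simp add: J_def)
    next
      assume "x \<in> {1}" then show ?thesis
        using K_pos by (intro exI[of _ "2 * d + 1"]) (simp add: J_def K_def)
    qed
  next
    case (crossing k)
    then show ?thesis using K_pos by (intro exI[of _ k]) (simp add: J_def divide_right_mono)
  next
    case (inside k s)
    then show ?thesis using K_pos by (intro exI[of _ k]) (simp add: J_def divide_right_mono)
  qed
  have "continuous_map (top_of_set {0..1}) (surface N) curve"
  proof (rule pasting_lemma_closed[where I = "{..2 * d + 1}" and T = "\<lambda>k. {0..1} \<inter> J k"
        and f = "\<lambda>k x. surf_pt N (side k, piece k (K * x - real k))"])
    show "closedin (top_of_set {0..1}) ({0..1} \<inter> J k)" for k
      unfolding J_def by (intro closedin_closed_Int closed_atLeastAtMost)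
    show "continuous_map (subtopology (top_of_set {0..1}) ({0..1} \<inter> J k)) (surface N)
      (\<lambda>x. surf_pt N (side k, piece k (K * x - real k)))" if "k \<in> {..2 * d + 1}" for k
      using cont[OF that] by (simp add: subtopology_subtopology)
    show "surf_pt N (side k, piece k (K * x - real k)) = surf_pt N (side k', piece k' (K * x - real k'))"
      if "k \<in> {..2 * d + 1}" "k' \<in> {..2 * d + 1}"
        "x \<in> topspace (top_of_set {0..1}) \<inter> ({0..1} \<inter> J k) \<inter> ({0..1} \<inter> J k')" for k k' x
      using on_J[of k x] on_J[of k' x] that by simp
    show "\<exists>k. k \<in> {..2 * d + 1} \<and> x \<in> {0..1} \<inter> J k \<and> curve x = surf_pt N (side k, piece k (K * x - real k))"
      if "x \<in> topspace (top_of_set {0..1})" for x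
      using cover[of x] on_J that by auto
  qed simp
  then show ?thesis by (simp add: pathin_def)
qed

lemma curve_initial: "curve ` {0..1 / (2 * K)} \<subseteq> L_seg N 1"
  and curve_final: "curve ` {1 - 1 / (2 * K)..1} \<subseteq> L_seg N 2"
proof -
  have seg: "half 0 s \<in> closed_segment 0 (gon_vertex N 0)" if "0 \<le> s" "s \<le> 1 / 2" for s
  proof -
    have "half 0 s = (1 - 2 * s) *\<^sub>R gon_vertex N 0"
      using that half_ends(1) by (simp add: half_def polar_radius_def polar_angle_def scaleR_conv_of_real)
    then show ?thesis using that unfolding closed_segment_def
      by (auto intro!: exI[of _ "1 - 2 * s"])
  qed
  show "curve ` {0..1 / (2 * K)} \<subseteq> L_seg N 1"
  proof (rule image_subsetI)
    fix x assume x: "x \<in> {0..1 / (2 * K)}"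
    have s: "0 \<le> K * x" "K * x \<le> 1 / 2" using x K_pos by (auto simp: field_simps)
    then have "curve x = surf_pt N (1, half 0 (K * x))"
      using curve_piece[of 0 "K * x"] K_pos by (simp add: side_def piece_def)
    then show "curve x \<in> L_seg N 1" using seg[OF s] by (auto simp: L_seg_def)
  qed
  show "curve ` {1 - 1 / (2 * K)..1} \<subseteq> L_seg N 2"
  proof (rule image_subsetI)
    fix x assume x: "x \<in> {1 - 1 / (2 * K)..1}"
    define s where "s = K * (1 - x)"
    have s: "0 \<le> s" "s \<le> 1 / 2" using x K_pos by (auto simp: s_def field_simps)
    have "real (2 * d + 1) + (1 - s) = K * x" by (simp add: s_def K_def algebra_simps)
    then have "x = (real (2 * d + 1) + (1 - s)) / K" using K_pos by simp
    then have "curve x = surf_pt N (2, half 0 s)"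
      using curve_piece[of "2 * d + 1" "1 - s"] s by (simp add: side_def piece_def)
    then show "curve x \<in> L_seg N 2" using seg[OF s] by (auto simp: L_seg_def)
  qed
qed

lemma curve_transversal:
  assumes x: "x \<in> {0..1}" and T: "curve x \<in> T_all N \<sigma> - V_pts N"
  shows "crosses_transversally N \<sigma> curve x"
  using x
proof (cases rule: time_cases)
  case ends
  then show ?thesis using T curve_V_iff x by simp
next
  case (inside k s)
  then show ?thesis using T curve_inside(3)[of k s \<sigma>] by simp
next
  case (crossing k)
  define \<epsilon> where "\<epsilon> = 1 / (2 * K)"
  have e: "\<epsilon> > 0" "K * \<epsilon> = 1 / 2" using K_pos by (auto simp: \<epsilon>_def)
  have Kx: "K * x = real k" using crossing K_pos by simp
  have k1: "1 \<le> real k" "real k \<le> K - 1" using crossing by (auto simp: K_def)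
  have "0 \<le> K * (x - \<epsilon>)" "K * (x + \<epsilon>) \<le> K * 1"
    using Kx e k1 by (simp_all add: algebra_simps)
  then have b: "0 \<le> x - \<epsilon>" "x + \<epsilon> \<le> 1" using K_pos by (simp_all only: zero_le_mult_iff mult_le_cancel_left_pos) auto
  have before: "curve y \<in> face N \<sigma> (side (k - 1))" if "y \<in> {x - \<epsilon>..<x}" for y
  proof -
    define s where "s = K * y - real (k - 1)"
    have "K * (x - \<epsilon>) \<le> K * y" "K * y < K * x" using that K_pos by simp_all
    then have s: "0 < s" "s < 1" using Kx e crossing by (simp_all add: s_def of_nat_diff algebra_simps)
    have "y = (real (k - 1) + s) / K" using K_pos by (simp add: s_def)
    then show ?thesis using curve_inside(2)[of "k - 1" s \<sigma>] s crossing by simp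
  qed
  have after: "curve y \<in> face N \<sigma> (side k)" if "y \<in> {x<..x + \<epsilon>}" for y
  proof -
    define s where "s = K * y - real k"
    have "K * y \<le> K * (x + \<epsilon>)" "K * x < K * y" using that K_pos by simp_all
    then have s: "0 < s" "s < 1" using Kx e by (simp_all add: s_def algebra_simps)
    have "y = (real k + s) / K" using K_pos by (simp add: s_def)
    then show ?thesis using curve_inside(2)[of k s \<sigma>] s crossing by simp
  qed
  have "{side (k - 1), side k} = {1, 2}" using crossing by (cases k) (auto simp: side_def)
  then show ?thesis unfolding crosses_transversally_def
    using e b before after by (intro exI[of _ \<epsilon>] conjI exI[of _ "side (k - 1)"] exI[of _ "side k"]) auto
qed

lemma crossing_times: "{x \<in> {0<..<1}. curve x \<in> T_all N id} = set (map (\<lambda>k. real k / K) [1..<2 * d + 2])"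
proof (intro equalityI subsetI)
  fix x assume x: "x \<in> {x \<in> {0<..<1}. curve x \<in> T_all N id}"
  then have "x \<in> {0..1}" by simp
  then show "x \<in> set (map (\<lambda>k. real k / K) [1..<2 * d + 2])"
  proof (cases rule: time_cases)
    case (inside k s)
    then show ?thesis using x curve_inside(3)[of k s id] by simp
  qed (use x in auto)
next
  fix x assume "x \<in> set (map (\<lambda>k. real k / K) [1..<2 * d + 2])"
  then obtain k where "k \<in> set [1..<2 * d + 2]" and x: "x = real k / K" unfolding set_map by blast
  then have k: "1 \<le> k" "k \<le> 2 * d + 1" by auto
  show "x \<in> {x \<in> {0<..<1}. curve x \<in> T_all N id}"
    using crossing_pos[of k] crossing_mem_T[of k] curve_crossing[of k] k by (simp add: x)
qed

lemma labels: "map edge_label [1..<2 * d + 2] = [i..<i + d] @ [i + d] @ rev [i..<i + d]"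
  by (rule nth_equalityI) (auto simp: edge_label_def nth_append rev_nth min_def)

lemma curve_word: "crossing_word N id curve = [i..<i + d] @ [i + d] @ rev [i..<i + d]"
proof -
  have "sorted_wrt (<) (map (\<lambda>k. real k / K) [1..<2 * d + 2])"
    unfolding sorted_wrt_map
    by (rule sorted_wrt_mono_rel[OF _ sorted_wrt_upt]) (simp add: divide_strict_right_mono K_pos)
  then have "sorted (map (\<lambda>k. real k / K) [1..<2 * d + 2])" "distinct (map (\<lambda>k. real k / K) [1..<2 * d + 2])"
    unfolding strict_sorted_iff by blast+
  then have "sorted_list_of_set {x \<in> {0<..<1}. curve x \<in> T_all N id} = map (\<lambda>k. real k / K) [1..<2 * d + 2]"
    unfolding crossing_times by (rule sorted_list_of_set.idem_if_sorted_distinct)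
  then have "crossing_word N id curve =
      map (\<lambda>k. THE j. j \<in> {1..N} \<and> curve (real k / K) \<in> T_edge N id j) [1..<2 * d + 2]"
    by (simp add: crossing_word_def o_def)
  also have "\<dots> = map edge_label [1..<2 * d + 2]"
  proof (rule map_cong[OF refl])
    fix k assume "k \<in> set [1..<2 * d + 2]"
    then have k: "1 \<le> k" "k \<le> 2 * d + 1" by auto
    show "(THE j. j \<in> {1..N} \<and> curve (real k / K) \<in> T_edge N id j) = edge_label k"
      using crossing_mem_T_edge_iff[OF k] edge_label_range[OF k] curve_crossing[OF k] by (intro the_equality) auto
  qed
  also have "\<dots> = [i..<i + d] @ [i + d] @ rev [i..<i + d]" by (rule labels)
  finally show ?thesis .
qed

lemma curve_simple:
  assumes xy: "x \<in> {0..1}" "y \<in> {0..1}" and eq: "curve x = curve y"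
  shows "x = y \<or> {x, y} = {0, 1}"
proof (cases "x \<in> {0, 1} \<or> y \<in> {0, 1}")
  case True
  then have "x \<in> {0, 1}" "y \<in> {0, 1}" using curve_V_iff xy eq by metis+
  then show ?thesis by auto
next
  case False
  have time: "(\<exists>k. 1 \<le> k \<and> k \<le> 2 * d + 1 \<and> z = real k / K) \<or>
      (\<exists>k s. k \<le> 2 * d + 1 \<and> 0 < s \<and> s < 1 \<and> z = (real k + s) / K)" if "z \<in> {0..1}" "z \<notin> {0, 1}" for z
    using that(1) by (cases rule: time_cases) (use that(2) in blast)+
  have mix: False if "1 \<le> k" "k \<le> 2 * d + 1" "k' \<le> 2 * d + 1" "0 < s" "s < 1"
      "curve (real k / K) = curve ((real k' + s) / K)" for k k' s
    using that curve_crossing[of k] crossing_mem_T[of k] curve_inside(3)[of k' s id] by simp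
  consider k k' where "1 \<le> k" "k \<le> 2 * d + 1" "x = real k / K" "1 \<le> k'" "k' \<le> 2 * d + 1" "y = real k' / K"
    | k k' s s' where "k \<le> 2 * d + 1" "0 < s" "s < 1" "x = (real k + s) / K"
        "k' \<le> 2 * d + 1" "0 < s'" "s' < 1" "y = (real k' + s') / K"
    using time[of x] time[of y] False xy eq mix by metis
  then show ?thesis
  proof cases
    case (1 k k')
    then have "k = k'" using crossing_inj curve_crossing eq by metis
    then show ?thesis using 1 by simp
  next
    case (2 k k' s s')
    then have "{(side k, piece k s)} = {(side k', piece k' s')}"
      using curve_inside(1) eq by metis
    then have "k = k' \<and> s = s'" using 2 by (intro piece_inj) auto
    then show ?thesis using 2 by simp
  qed
qed

end

section \<open>Roots of simple admissible curves\<close>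

lemma id_quiver_perms: "id \<in> quiver_perms (equioriented_A n)"
  by (auto simp: quiver_perms_def arcs_A permutes_id)

lemma curve_root_A_interval:
  assumes "\<eta> \<in> simple_admissible (equioriented_A n) \<sigma>"
  obtains a b where "1 \<le> a" "a \<le> b" "b \<le> n" "curve_root (equioriented_A n) \<sigma> \<eta> = A_root a (Suc b)"
proof -
  define r where "r = word_prod (equioriented_A n) (crossing_word n \<sigma> \<eta>)"
  have "crossing_word n \<sigma> \<eta> \<in> R_words (equioriented_A n)"
    using assms by (simp add: simple_admissible_def admissible_curve_def Let_def)
  then have "r \<in> reflections (equioriented_A n)"
    by (auto simp: R_words_def R_words_of_def r_def)
  then obtain a b where "1 \<le> a" "a < b" "b \<le> Suc n" "root_of_reflection (equioriented_A n) r = A_root a b"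
    by (rule root_of_reflection_A_interval)
  then show ?thesis using that[of a "b - 1"] by (simp add: curve_root_def r_def)
qed

lemma zigzag_curve_admissible:
  assumes n: "2 \<le> n" and ab: "1 \<le> a" "a \<le> b" "b \<le> n"
  shows "zigzag.curve n a (b - a) \<in> simple_admissible (equioriented_A n) id"
    and "curve_root (equioriented_A n) id (zigzag.curve n a (b - a)) = A_root a (Suc b)"
proof -
  interpret zigzag n a "b - a" using n ab by unfold_locales auto
  have word: "crossing_word n id curve = [a..<b] @ [b] @ rev [a..<b]"
    using curve_word ab by simp
  have "0 < 1 / (2 * K)" "1 / (2 * K) \<le> 1" using K_ge_2 by (simp_all add: field_simps)
  then have "\<exists>\<epsilon>>0. \<epsilon> \<le> 1 \<and> curve ` {0..\<epsilon>} \<subseteq> L_seg n 1 \<and> curve ` {1 - \<epsilon>..1} \<subseteq> L_seg n 2"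
    using curve_initial curve_final by blast
  then have "admissible_curve (equioriented_A n) id curve"
    using curve_path curve_V_iff curve_transversal palindrome_word(1)[OF ab] word
    by (simp add: admissible_curve_def Let_def)
  then show "curve \<in> simple_admissible (equioriented_A n) id"
    using curve_simple by (simp add: simple_admissible_def)
  show "curve_root (equioriented_A n) id curve = A_root a (Suc b)"
    using palindrome_word(2)[OF ab] word by (simp add: curve_root_def)
qed

theorem mainTheorem2:
  fixes n :: nat
  assumes "n \<ge> 2"
  shows "(\<Union>\<sigma>\<in>quiver_perms (equioriented_A n).
            curve_root (equioriented_A n) \<sigma> ` simple_admissible (equioriented_A n) \<sigma>)
         = real_Schur_roots TYPE('k::alg_closed_field) (equioriented_A n)"
  unfolding real_Schur_roots_A
proof (intro equalityI subsetI)
  fix \<beta> assume "\<beta> \<in> (\<Union>\<sigma>\<in>quiver_perms (equioriented_A n).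
      curve_root (equioriented_A n) \<sigma> ` simple_admissible (equioriented_A n) \<sigma>)"
  then obtain \<sigma> \<eta> where "\<eta> \<in> simple_admissible (equioriented_A n) \<sigma>"
    and \<beta>: "\<beta> = curve_root (equioriented_A n) \<sigma> \<eta>" by blast
  then obtain a b where "1 \<le> a" "a \<le> b" "b \<le> n" "\<beta> = A_root a (Suc b)"
    unfolding \<beta> by (blast elim: curve_root_A_interval)
  then show "\<beta> \<in> {A_root a (Suc b) | a b. 1 \<le> a \<and> a \<le> b \<and> b \<le> n}" by blast
next
  fix \<beta> assume "\<beta> \<in> {A_root a (Suc b) | a b. 1 \<le> a \<and> a \<le> b \<and> b \<le> n}"
  then obtain a b where ab: "1 \<le> a" "a \<le> b" "b \<le> n" and \<beta>: "\<beta> = A_root a (Suc b)" by blast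
  have "\<beta> \<in> curve_root (equioriented_A n) id ` simple_admissible (equioriented_A n) id"
    unfolding \<beta> zigzag_curve_admissible(2)[OF assms ab, symmetric]
    by (rule imageI, rule zigzag_curve_admissible(1)[OF assms ab])
  then show "\<beta> \<in> (\<Union>\<sigma>\<in>quiver_perms (equioriented_A n).
      curve_root (equioriented_A n) \<sigma> ` simple_admissible (equioriented_A n) \<sigma>)"
    by (rule UN_I[OF id_quiver_perms])
qed

end
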